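(* (a) The discrete mixture representation $\chi_1^2(\theta)=\sum_{k=0}^\infty \mathrm{Po}(\theta/2)(\{k\})\,\chi^2_{2k+1}$ of the family $\{\chi_1^2(\theta):\theta\ge 0\}$ is not minimal, i.e. $$\mathrm{Mix}\{\chi_1^2(\theta):\theta\ge0\}\subsetneqq \mathrm{Mix}\{\chi_{1+2k}^2:k\in\mathbb{N}_0\}.$$ Further, each $\chi_1^2(\eta)$, $\eta\ge0$, is extremal in $\mathrm{Mix}\{\chi_1^2(\theta):\theta\ge0\}$, and a minimal discrete mixture representation of $\{\chi_1^2(\theta):\theta\ge0\}$ does not exist. (b) The discrete mixture representation $\chi_n^2(\theta)=\sum_{k=0}^\infty \mathrm{Po}(\theta/2)(\{k\})\,\chi^2_{2k+n}$ of the family $\{\chi_n^2(\theta):\theta\ge0,\,n\in\mathbb{N}\}$, with mixing distributions $\{\chi_k^2:k\in\mathbb{N}\}$, is minimal, i.e. $$\mathrm{Mix}\{\chi_k^2(\theta):\theta\ge0,\,k\in\mathbb{N}\}=\mathrm{Mix}\{\chi_k^2:k\in\mathbb{N}\}.$$ (c) If $k,l\in\mathbb{N}$ have different parities, i.e. if $|k-l|$ is odd, then $$\mathrm{Mix}\{\chi_k^2(\theta):\theta\ge0\}\cap\mathrm{Mix}\{\chi_l^2(\theta):\theta\ge0\}=\emptyset.$$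
   Context: $\mathbb{N}=\{1,2,\dots\}$, $\mathbb{N}_0=\mathbb{N}\cup\{0\}$. $\mathrm{Po}(\lambda)$ is the Poisson distribution with parameter $\lambda\geq 0$ ($\mathrm{Po}(0)=\delta_0$). $\chi_m^2$ is the central chi-squared distribution with $m$ degrees of freedom, and $\chi_n^2(\theta)$, $\theta\ge0$, is the noncentral chi-squared distribution with $n$ degrees of freedom and noncentrality parameter $\theta$; it satisfies $\chi_n^2(\theta)=\sum_{k=0}^\infty\mathrm{Po}(\theta/2)(\{k\})\,\chi_{2k+n}^2$, and $\chi_n^2(0)=\chi_n^2$. Mixtures: for a measurable space $(E,\mathcal{E})$ and a Markov kernel $Q$ from $(E,\mathcal{E})$ to $(S,\mathcal{S})$, $\mathrm{Mix}\{Q(y,\cdot):y\in E\}$ is the set of all probability measures on $(S,\mathcal{S})$ of the form $A\mapsto\int Q(y,A)\,\tau(dy)$, where $\tau$ ranges over all probability measures on $(E,\mathcal{E})$. Countable index sets carry the power set, $[0,\infty)$ its Borel $\sigma$-field, and $[0,\infty)\times\mathbb{N}$ the product $\sigma$-field. Discrete mixture representation: a representation $P_\theta=\sum_{i\in E}w_\theta(i)\,Q_i$, $\theta\in\Theta$, with $E$ finite or countably infinite, probability measures $Q_i$ not depending on $\theta$, and probability mass functions $w_\theta$ on $E$. It is called minimal if $\mathrm{Mix}\{P_\theta:\theta\in\Theta\}=\mathrm{Mix}\{Q_i:i\in E\}$. Extremal: an element $\mu$ of a convex set $M$ of probability measures is extremal (an extreme element) in $M$ if $\mu=\alpha\mu_1+(1-\alpha)\mu_2$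 with $\mu_1,\mu_2\in M$ and $0<\alpha<1$ implies $\mu_1=\mu_2=\mu$. *)

theory Defs
  imports "HOL-Probability.Probability"
begin

section \<open>Mixtures\<close>

text \<open>
  Here \<open>Q\<close> is meant to be a Markov kernel from \<open>E\<close> to \<open>S\<close>, i.e.
  \<open>Q \<in> E \<rightarrow>\<^sub>M prob_algebra S\<close>. Mixing measures live on the sigma-algebra of \<open>E\<close>, so
  a countable index set \<open>I\<close> with its power set is passed as \<open>count_space I\<close>.
\<close>

definition Mix :: "'e measure \<Rightarrow> 's measure \<Rightarrow> ('e \<Rightarrow> 's measure) \<Rightarrow> 's measure set" where
  "Mix E S Q = {\<mu>. prob_space \<mu> \<and> sets \<mu> = sets S \<and>
     (\<exists>\<tau>. prob_space \<tau> \<and> sets \<tau> = sets E \<and>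
        (\<forall>A\<in>sets S. emeasure \<mu> A = (\<integral>\<^sup>+ y. emeasure (Q y) A \<partial>\<tau>)))}"

definition extremal_in :: "'s measure \<Rightarrow> 's measure set \<Rightarrow> 's measure \<Rightarrow> bool" where
  "extremal_in S M \<mu> \<longleftrightarrow> \<mu> \<in> M \<and>
     (\<forall>\<mu>1\<in>M. \<forall>\<mu>2\<in>M. \<forall>\<alpha>::real. 0 < \<alpha> \<and> \<alpha> < 1 \<and>
        (\<forall>A\<in>sets S. measure \<mu> A = \<alpha> * measure \<mu>1 A + (1 - \<alpha>) * measure \<mu>2 A)
        \<longrightarrow> \<mu>1 = \<mu> \<and> \<mu>2 = \<mu>)"

text \<open>
  The parameter set is the space of the measurable space \<open>T\<close> (only its sigma-algebra matters).
\<close>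

definition discrete_mixture_rep ::
  "'t measure \<Rightarrow> 's measure \<Rightarrow> ('t \<Rightarrow> 's measure) \<Rightarrow>
   'i set \<Rightarrow> ('t \<Rightarrow> 'i \<Rightarrow> real) \<Rightarrow> ('i \<Rightarrow> 's measure) \<Rightarrow> bool" where
  "discrete_mixture_rep T S P I w Q \<longleftrightarrow>
     countable I \<and>
     (\<forall>i\<in>I. prob_space (Q i) \<and> sets (Q i) = sets S) \<and>
     (\<forall>\<theta>\<in>space T.
        prob_space (P \<theta>) \<and> sets (P \<theta>) = sets S \<and>
        (\<forall>i\<in>I. 0 \<le> w \<theta> i) \<and> (w \<theta> has_sum 1) I \<and>
        (\<forall>A\<in>sets S. ((\<lambda>i. w \<theta> i * measure (Q i) A) has_sum measure (P \<theta>) A) I))"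

definition minimal_discrete_mixture_rep ::
  "'t measure \<Rightarrow> 's measure \<Rightarrow> ('t \<Rightarrow> 's measure) \<Rightarrow>
   'i set \<Rightarrow> ('t \<Rightarrow> 'i \<Rightarrow> real) \<Rightarrow> ('i \<Rightarrow> 's measure) \<Rightarrow> bool" where
  "minimal_discrete_mixture_rep T S P I w Q \<longleftrightarrow>
     discrete_mixture_rep T S P I w Q \<and> Mix T S P = Mix (count_space I) S Q"

section \<open>Poisson and chi-squared distributions\<close>

text \<open>
  The library's \<open>poisson_pmf\<close> requires a positive rate. Since \<open>0 ^ 0 = 1\<close>, the function below
  is the mass function of the point mass at 0 for \<open>l = 0\<close>.
\<close>

definition poisson_mass :: "real \<Rightarrow> nat \<Rightarrow> real" where
  "poisson_mass l k = l ^ k / fact k * exp (- l)"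

definition chi_square :: "nat \<Rightarrow> real measure" where
  "chi_square m = density lborel (\<lambda>x. ennreal
     (if 0 < x
      then x powr (real m / 2 - 1) * exp (- x / 2) / (2 powr (real m / 2) * Gamma (real m / 2))
      else 0))"

text \<open>
  The law of the squared Euclidean norm of a standard normal vector in dimension \<open>n \<ge> 1\<close>
  shifted by the vector \<open>(sqrt \<theta>, 0, \<dots>, 0)\<close>; by rotation invariance any shift of squared
  norm \<open>\<theta>\<close> gives the same law.
\<close>

definition noncentral_chi_square :: "nat \<Rightarrow> real \<Rightarrow> real measure" where
  "noncentral_chi_square n \<theta> =
     distr (\<Pi>\<^sub>M i\<in>{..<n}. std_normal_distribution) borel
       (\<lambda>z. \<Sum>i<n. (z i + (if i = 0 then sqrt \<theta> else 0))\<^sup>2)"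

abbreviation nonneg_borel :: "real measure" where
  "nonneg_borel \<equiv> restrict_space borel {0..}"

text \<open>
  Weight of the central distribution with \<open>j\<close> degrees of freedom in the noncentral one with
  parameters \<open>(\<theta>, n)\<close>: the image of the Poisson distribution with parameter \<open>\<theta>/2\<close> under
  \<open>k \<mapsto> 2 * k + n\<close>.
\<close>

definition chi_square_weight :: "real \<times> nat \<Rightarrow> nat \<Rightarrow> real" where
  "chi_square_weight = (\<lambda>(\<theta>, n) j.
     if n \<le> j \<and> even (j - n) then poisson_mass (\<theta> / 2) ((j - n) div 2) else 0)"

lemma noncentral_chi_square_kernel:
  "noncentral_chi_square n \<in> nonneg_borel \<rightarrow>\<^sub>M prob_algebra borel"
proof -
  let ?N = "std_normal_distribution :: real measure"
  let ?P = "\<Pi>\<^sub>M i\<in>{..<n}. ?N"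
  have "prob_space ?P"
    by (intro prob_space_PiM prob_space_normal_density) simp
  have const: "(\<lambda>_::real. ?P) \<in> nonneg_borel \<rightarrow>\<^sub>M prob_algebra ?P"
    by (intro measurable_const) (simp add: space_prob_algebra \<open>prob_space ?P\<close>)
  have [measurable]: "(\<lambda>\<theta>::real. \<theta>) \<in> nonneg_borel \<rightarrow>\<^sub>M borel"
    by (rule measurable_restrict_space1) simp
  have [measurable]: "(\<lambda>p. snd p i) \<in> nonneg_borel \<Otimes>\<^sub>M ?P \<rightarrow>\<^sub>M (borel :: real measure)"
    if "i < n" for i
    using measurable_compose[OF measurable_snd measurable_component_singleton, of i "{..<n}"] that
    by (auto cong: measurable_cong_sets)
  have sqrt_fst: "(\<lambda>p. sqrt (fst p)) \<in> nonneg_borel \<Otimes>\<^sub>M ?P \<rightarrow>\<^sub>M borel"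
    by (intro measurable_compose[OF measurable_fst] measurable_restrict_space1) simp
  have "(\<lambda>(\<theta>, z). \<Sum>i<n. (z i + (if i = 0 then sqrt \<theta> else 0))\<^sup>2)
        \<in> nonneg_borel \<Otimes>\<^sub>M ?P \<rightarrow>\<^sub>M borel"
    unfolding case_prod_beta
    by (intro borel_measurable_sum borel_measurable_power borel_measurable_add)
       (auto intro: sqrt_fst)
  from measurable_distr_prob_space2[OF const this] show ?thesis
    unfolding noncentral_chi_square_def[abs_def] .
qed

lemma noncentral_chi_square_pair_kernel:
  "(\<lambda>(\<theta>, n). noncentral_chi_square n \<theta>)
     \<in> nonneg_borel \<Otimes>\<^sub>M count_space {1..} \<rightarrow>\<^sub>M prob_algebra borel"
  unfolding case_prod_beta
  by (rule measurable_compose_countable'[where I = "{1..}" and g = snd])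
     (auto intro: measurable_compose[OF measurable_fst noncentral_chi_square_kernel])

end

theory Submission
  imports Defs
begin

text \<open>
  Everything rests on two facts. First, a noncentral distribution with \<open>n\<close> degrees of freedom
  and noncentrality \<open>\<theta>\<close> is a mixture, with Poisson weights of rate \<open>\<theta> / 2\<close>, of the central
  distributions with \<open>2 * k + n\<close> degrees of freedom (\<open>emeasure_noncentral_chi_square\<close>): for
  \<open>n = 1\<close> this is the power series of \<open>cosh\<close>, and further dimensions convolve every component
  with \<open>chi_square 1\<close>. Second, a mixture of central chi-squared distributions determines its
  mixing weights (\<open>chi_square_mixture_unique\<close>), because its Laplace transform is, in a suitable
  variable, the generating function of the weights.

  Consequently a mixture of noncentral distributions can be identified with its averaged Poisson
  weights. All claims become statements about these weights. The averaged weight of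
  \<open>chi_square 1\<close> in a mixture of the \<open>noncentral_chi_square 1 \<theta>\<close> is positive, so \<open>chi_square 3\<close>
  is no such mixture. Different parities of the degrees of freedom lead to weights with disjoint
  supports. If all degrees of freedom are admitted, the noncentral distributions include the
  central ones as the case \<open>\<theta> = 0\<close>, so the two families generate the same mixtures.

  For extremality, a certain combination of the Poisson weights at 0, 1 and 2 is nonnegative at
  every rate and vanishes only at the rate \<open>\<eta> / 2\<close>; therefore \<open>noncentral_chi_square 1 \<eta>\<close> arises
  only from the mixing measure concentrated at \<open>\<eta>\<close>
  (\<open>noncentral_chi_square_mixing_concentrated\<close>). Finally, every extremal mixture of countably
  many distributions is one of them (\<open>extremal_in_countable_Mix\<close>). As the extremal points
  \<open>noncentral_chi_square 1 \<eta>\<close> are uncountably many, no discrete representation of this family is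
  minimal.
\<close>

section \<open>Mixtures\<close>

text \<open>
  Writing a mixture as a bind in the Giry monad turns integration against the mixture into an
  iterated integral.
\<close>
lemma mixture_eq_bind:
  assumes "Q \<in> E \<rightarrow>\<^sub>M subprob_algebra S" "space E \<noteq> {}" "sets \<mu> = sets S"
    and "\<And>A. A \<in> sets S \<Longrightarrow> emeasure \<mu> A = (\<integral>\<^sup>+y. emeasure (Q y) A \<partial>E)"
  shows "\<mu> = E \<bind> Q"
  using assms by (intro measure_eqI) (auto simp: sets_bind_measurable emeasure_bind)

lemma nn_integral_mixture:
  assumes "Q \<in> E \<rightarrow>\<^sub>M subprob_algebra S" "space E \<noteq> {}" "sets \<mu> = sets S"
    and "\<And>A. A \<in> sets S \<Longrightarrow> emeasure \<mu> A = (\<integral>\<^sup>+y. emeasure (Q y) A \<partial>E)"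
    and "f \<in> borel_measurable S"
  shows "(\<integral>\<^sup>+x. f x \<partial>\<mu>) = (\<integral>\<^sup>+y. \<integral>\<^sup>+x. f x \<partial>Q y \<partial>E)"
  by (subst mixture_eq_bind[OF assms(1-4)], assumption, rule nn_integral_bind[OF assms(5,1)])

lemma bind_in_Mix:
  assumes \<tau>: "prob_space \<tau>" "sets \<tau> = sets E" and Q: "Q \<in> E \<rightarrow>\<^sub>M prob_algebra S"
  shows "\<tau> \<bind> Q \<in> Mix E S Q"
    and "\<And>A. A \<in> sets S \<Longrightarrow> emeasure (\<tau> \<bind> Q) A = (\<integral>\<^sup>+y. emeasure (Q y) A \<partial>\<tau>)"
proof -
  have \<tau>': "\<tau> \<in> space (prob_algebra E)" using \<tau> by (simp add: space_prob_algebra)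
  show *: "emeasure (\<tau> \<bind> Q) A = (\<integral>\<^sup>+y. emeasure (Q y) A \<partial>\<tau>)" if "A \<in> sets S" for A
    by (rule emeasure_bind_prob_algebra[OF \<tau>' Q that])
  have "prob_space (\<tau> \<bind> Q)" by (rule prob_space_bind'[OF \<tau>' Q])
  thus "\<tau> \<bind> Q \<in> Mix E S Q"
    using \<tau> * sets_bind'[OF \<tau>' Q] by (auto simp: Mix_def)
qed

lemma kernel_in_Mix:
  assumes Q: "Q \<in> E \<rightarrow>\<^sub>M prob_algebra S" and y: "y \<in> space E"
  shows "Q y \<in> Mix E S Q"
  using bind_in_Mix(1)[OF prob_space_return[OF y] sets_return Q]
    bind_return[OF measurable_prob_algebraD[OF Q] y] by simp

lemma density_count_space_singletons:
  assumes "countable I" "sets \<sigma> = Pow I"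
  shows "density (count_space I) (\<lambda>i. emeasure \<sigma> {i}) = \<sigma>"
proof (rule measure_eqI_countable[of _ I])
  fix i assume i: "i \<in> I"
  hence "emeasure (density (count_space I) (\<lambda>i. emeasure \<sigma> {i})) {i}
      = (\<integral>\<^sup>+j. emeasure \<sigma> {j} * indicator {i} j \<partial>count_space I)"
    by (subst emeasure_density) auto
  also have "\<dots> = emeasure \<sigma> {i}"
    using i by (subst nn_integral_indicator_singleton) auto
  finally show "emeasure (density (count_space I) (\<lambda>i. emeasure \<sigma> {i})) {i} = emeasure \<sigma> {i}" .
qed (simp_all add: assms)

lemma prob_space_countable_atom:
  assumes \<tau>: "prob_space \<tau>" "sets \<tau> = Pow I" and I: "countable I"
  shows "\<exists>i\<in>I. emeasure \<tau> {i} \<noteq> 0"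
proof (rule ccontr)
  assume "\<not> ?thesis"
  hence "density (count_space I) (\<lambda>i. emeasure \<tau> {i}) = density (count_space I) (\<lambda>i. 0)"
    by (intro density_cong) (auto simp: AE_count_space)
  hence "emeasure \<tau> (space \<tau>) = emeasure (density (count_space I) (\<lambda>i. 0)) I"
    using density_count_space_singletons[OF I \<tau>(2)] sets_eq_imp_space_eq[of \<tau> "count_space I"] \<tau>(2) by simp
  thus False using prob_space.emeasure_space_1[OF \<tau>(1)] by (simp add: emeasure_density)
qed

text \<open>
  A countable mixing measure \<open>\<tau>\<close> has an atom \<open>i\<close>, say of mass \<open>p\<close>. Unless \<open>p = 1\<close>, conditioning
  \<open>\<tau>\<close> on the remaining indices displays the mixture as a proper convex combination of \<open>Q i\<close> and
  another mixture, and extremality identifies \<open>Q i\<close> with it. Hence the mixtures of countably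
  many distributions have only countably many extremal points.
\<close>
lemma extremal_in_countable_Mix:
  assumes I: "countable I" and Q: "\<And>i. i \<in> I \<Longrightarrow> prob_space (Q i) \<and> sets (Q i) = sets S"
    and ext: "extremal_in S (Mix (count_space I) S Q) \<mu>"
  shows "\<exists>i\<in>I. Q i = \<mu>"
proof -
  have kernel: "Q \<in> count_space I \<rightarrow>\<^sub>M prob_algebra S"
    using Q by (auto simp: space_prob_algebra)
  from ext obtain \<tau> where \<mu>: "prob_space \<mu>" "sets \<mu> = sets S"
    and \<tau>: "prob_space \<tau>" "sets \<tau> = Pow I"
    and eq: "\<And>A. A \<in> sets S \<Longrightarrow> emeasure \<mu> A = (\<integral>\<^sup>+i. emeasure (Q i) A \<partial>\<tau>)"
    unfolding extremal_in_def Mix_def by auto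
  interpret \<tau>: prob_space \<tau> by fact
  interpret \<mu>: prob_space \<mu> by fact
  have sp: "space \<tau> = I" using sets_eq_imp_space_eq[of \<tau> "count_space I"] \<tau> by simp
  have meas: "f \<in> borel_measurable \<tau>" for f :: "_ \<Rightarrow> ennreal"
    by (subst measurable_cong_sets[of \<tau> "count_space I" borel borel]) (simp_all add: \<tau>(2))
  obtain i where i: "i \<in> I" "emeasure \<tau> {i} \<noteq> 0"
    using prob_space_countable_atom[OF \<tau> I] by blast
  have [measurable]: "{i} \<in> sets \<tau>" "I - {i} \<in> sets \<tau>" using i \<tau> by auto
  define p where "p = measure \<tau> {i}"
  have p: "emeasure \<tau> {i} = ennreal p" "emeasure \<tau> (I - {i}) = ennreal (1 - p)" "p \<noteq> 0" "0 \<le> p"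
    using i \<tau>.prob_compl[of "{i}"] by (auto simp: p_def \<tau>.emeasure_eq_measure sp)
  have split: "emeasure \<mu> A = ennreal p * emeasure (Q i) A
      + (\<integral>\<^sup>+j. emeasure (Q j) A * indicator (I - {i}) j \<partial>\<tau>)" if "A \<in> sets S" for A
  proof -
    have "emeasure \<mu> A = (\<integral>\<^sup>+j. emeasure (Q j) A * indicator {i} j
        + emeasure (Q j) A * indicator (I - {i}) j \<partial>\<tau>)"
      unfolding eq[OF that] by (intro nn_integral_cong) (auto simp: sp indicator_def)
    also have "\<dots> = (\<integral>\<^sup>+j. emeasure (Q j) A * indicator {i} j \<partial>\<tau>)
        + (\<integral>\<^sup>+j. emeasure (Q j) A * indicator (I - {i}) j \<partial>\<tau>)"
      by (intro nn_integral_add meas)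
    also have "(\<integral>\<^sup>+j. emeasure (Q j) A * indicator {i} j \<partial>\<tau>) = ennreal p * emeasure (Q i) A"
      by (subst nn_integral_indicator_singleton) (auto simp: p mult.commute)
    finally show ?thesis .
  qed
  have "Q i = \<mu>"
  proof (cases "p = 1")
    case True
    have "emeasure \<mu> A = emeasure (Q i) A" if "A \<in> sets S" for A
    proof -
      have "AE j in \<tau>. j \<notin> I - {i}"
        using p True by (intro AE_not_in) (auto simp: null_sets_def)
      hence "(\<integral>\<^sup>+j. emeasure (Q j) A * indicator (I - {i}) j \<partial>\<tau>) = (\<integral>\<^sup>+j. 0 \<partial>\<tau>)"
        by (intro nn_integral_cong_AE) (auto elim!: eventually_mono)
      thus ?thesis using split[OF that] True by simp
    qed
    thus ?thesis using Q[OF i(1)] \<mu> by (intro measure_eqI) auto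
  next
    case False
    with p have p1: "0 < p" "p < 1" using \<tau>.prob_le_1[of "{i}"] unfolding p_def[symmetric] by auto
    define \<tau>' where "\<tau>' = uniform_measure \<tau> (I - {i})"
    have \<tau>': "prob_space \<tau>'" "sets \<tau>' = sets (count_space I)"
      using p p1 \<tau> by (auto simp: \<tau>'_def intro!: prob_space_uniform_measure)
    define \<nu> where "\<nu> = \<tau>' \<bind> Q"
    have \<nu>: "\<nu> \<in> Mix (count_space I) S Q"
      unfolding \<nu>_def by (rule bind_in_Mix(1)[OF \<tau>' kernel])
    interpret Qi: prob_space "Q i" using Q[OF i(1)] by simp
    interpret \<nu>: prob_space \<nu> using \<nu> by (simp add: Mix_def)
    have decomp: "measure \<mu> A = p * measure (Q i) A + (1 - p) * measure \<nu> A" if A: "A \<in> sets S" for A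
    proof -
      have "emeasure \<nu> A = (\<integral>\<^sup>+j. emeasure (Q j) A * indicator (I - {i}) j \<partial>\<tau>) / ennreal (1 - p)"
        unfolding \<nu>_def bind_in_Mix(2)[OF \<tau>' kernel A] unfolding \<tau>'_def
        by (subst nn_integral_uniform_measure) (auto simp: p meas)
      hence "ennreal (1 - p) * emeasure \<nu> A
          = (\<integral>\<^sup>+j. emeasure (Q j) A * indicator (I - {i}) j \<partial>\<tau>)"
        using p1
        by (simp add: ennreal_times_divide mult.commute[of "ennreal (1 - p)"] mult_divide_eq_ennreal)
      with split[OF A] have "emeasure \<mu> A = ennreal p * emeasure (Q i) A + ennreal (1 - p) * emeasure \<nu> A"
        by simp
      hence "ennreal (measure \<mu> A) = ennreal (p * measure (Q i) A + (1 - p) * measure \<nu> A)"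
        using p1 by (simp add: \<mu>.emeasure_eq_measure Qi.emeasure_eq_measure \<nu>.emeasure_eq_measure
          ennreal_mult)
      thus ?thesis using p1 by (subst (asm) ennreal_inj) auto
    qed
    have "Q i \<in> Mix (count_space I) S Q" using i(1) by (intro kernel_in_Mix[OF kernel]) simp
    with ext have "\<forall>\<mu>2\<in>Mix (count_space I) S Q. \<forall>\<alpha>. 0 < \<alpha> \<and> \<alpha> < 1 \<and>
        (\<forall>A\<in>sets S. measure \<mu> A = \<alpha> * measure (Q i) A + (1 - \<alpha>) * measure \<mu>2 A)
        \<longrightarrow> Q i = \<mu> \<and> \<mu>2 = \<mu>"
      unfolding extremal_in_def by blast
    with \<nu> p1 decomp show ?thesis by blast
  qed
  thus ?thesis using i(1) by blast
qed

section \<open>Discrete mixture representations\<close>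

text \<open>
  This passes between unordered sums of reals, in which discrete representations are phrased,
  and extended nonnegative integrals, for which Fubini needs no integrability.
\<close>
lemma has_sum_iff_nn_integral_count_space:
  fixes f :: "'i \<Rightarrow> real"
  assumes f: "\<And>i. i \<in> I \<Longrightarrow> 0 \<le> f i" and s: "0 \<le> s"
  shows "(f has_sum s) I \<longleftrightarrow> (\<integral>\<^sup>+i. ennreal (f i) \<partial>count_space I) = ennreal s"
proof
  assume sum: "(f has_sum s) I"
  hence "(\<lambda>i. norm (f i)) summable_on I"
    using summable_on_iff_abs_summable_on_real[of f I] by (auto simp: summable_on_def)
  hence abs: "Infinite_Set_Sum.abs_summable_on f I" by (rule abs_summable_equivalent[THEN iffD1])
  thus "(\<integral>\<^sup>+i. ennreal (f i) \<partial>count_space I) = ennreal s"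
    using f infsumI[OF sum] by (simp add: nn_integral_conv_infsetsum infsetsum_infsum)
next
  assume eq: "(\<integral>\<^sup>+i. ennreal (f i) \<partial>count_space I) = ennreal s"
  hence "integrable (count_space I) f"
    using f by (intro integrableI_nonneg) (auto simp: AE_count_space)
  hence abs: "Infinite_Set_Sum.abs_summable_on f I" by (simp add: abs_summable_on_def)
  hence "(\<lambda>i. norm (f i)) summable_on I" by (rule abs_summable_equivalent[THEN iffD2])
  hence "(f has_sum infsum f I) I"
    using summable_on_iff_abs_summable_on_real[of f I] by simp
  moreover have "infsum f I = s"
    using eq f s abs by (simp add: infsetsum_infsum[symmetric] infsetsum_conv_nn_integral)
  ultimately show "(f has_sum s) I" by simp
qed

text \<open>
  Applied to the whole space, the decomposition says that the weights sum to 1.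
\<close>
lemma discrete_mixture_repI:
  assumes "\<And>i. i \<in> I \<Longrightarrow> prob_space (Q i)" "\<And>i. i \<in> I \<Longrightarrow> sets (Q i) = sets S"
    and "\<And>\<theta>. \<theta> \<in> space T \<Longrightarrow> prob_space (P \<theta>)" "\<And>\<theta>. \<theta> \<in> space T \<Longrightarrow> sets (P \<theta>) = sets S"
    and "\<And>\<theta> i. \<theta> \<in> space T \<Longrightarrow> i \<in> I \<Longrightarrow> 0 \<le> w \<theta> i"
    and "\<And>\<theta> A. \<theta> \<in> space T \<Longrightarrow> A \<in> sets S \<Longrightarrow>
       emeasure (P \<theta>) A = (\<integral>\<^sup>+i. ennreal (w \<theta> i) * emeasure (Q i) A \<partial>count_space I)"
    and "countable I"
  shows "discrete_mixture_rep T S P I w Q"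
proof -
  have sum: "((\<lambda>i. w \<theta> i * measure (Q i) A) has_sum measure (P \<theta>) A) I"
    if \<theta>: "\<theta> \<in> space T" and A: "A \<in> sets S" for \<theta> A
  proof -
    have "(\<integral>\<^sup>+i. ennreal (w \<theta> i * measure (Q i) A) \<partial>count_space I)
        = (\<integral>\<^sup>+i. ennreal (w \<theta> i) * emeasure (Q i) A \<partial>count_space I)"
      using assms(1) assms(5)[OF \<theta>]
      by (intro nn_integral_cong)
         (simp add: ennreal_mult finite_measure.emeasure_eq_measure prob_space.finite_measure)
    also have "\<dots> = ennreal (measure (P \<theta>) A)"
      using assms(6)[OF \<theta> A] assms(3)[OF \<theta>]
      by (simp add: finite_measure.emeasure_eq_measure prob_space.finite_measure)
    finally show ?thesis
      using assms(5)[OF \<theta>] by (subst has_sum_iff_nn_integral_count_space) auto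
  qed
  have "(w \<theta> has_sum 1) I" if \<theta>: "\<theta> \<in> space T" for \<theta>
  proof -
    have "measure (P \<theta>) (space S) = 1"
      using prob_space.prob_space[OF assms(3)[OF \<theta>]] sets_eq_imp_space_eq[OF assms(4)[OF \<theta>]] by simp
    moreover have "w \<theta> i * measure (Q i) (space S) = w \<theta> i" if "i \<in> I" for i
      using prob_space.prob_space[OF assms(1)[OF that]] sets_eq_imp_space_eq[OF assms(2)[OF that]] by simp
    ultimately show ?thesis
      using sum[OF \<theta> sets.top] has_sum_cong[of I "\<lambda>i. w \<theta> i * measure (Q i) (space S)" "w \<theta>"] by simp
  qed
  with sum assms(1-5,7) show ?thesis
    unfolding discrete_mixture_rep_def by auto
qed

lemma discrete_mixture_rep_emeasure:
  assumes "discrete_mixture_rep T S P I w Q" "\<theta> \<in> space T" "A \<in> sets S"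
  shows "emeasure (P \<theta>) A = (\<integral>\<^sup>+i. ennreal (w \<theta> i) * emeasure (Q i) A \<partial>count_space I)"
proof -
  have P: "prob_space (P \<theta>)" and Q: "\<And>i. i \<in> I \<Longrightarrow> prob_space (Q i)"
    and w: "\<And>i. i \<in> I \<Longrightarrow> 0 \<le> w \<theta> i"
    and s: "((\<lambda>i. w \<theta> i * measure (Q i) A) has_sum measure (P \<theta>) A) I"
    using assms unfolding discrete_mixture_rep_def by auto
  from s w have "ennreal (measure (P \<theta>) A) = (\<integral>\<^sup>+i. ennreal (w \<theta> i * measure (Q i) A) \<partial>count_space I)"
    by (subst (asm) has_sum_iff_nn_integral_count_space) auto
  thus ?thesis
    using P Q w by (simp add: finite_measure.emeasure_eq_measure prob_space.finite_measure ennreal_mult cong: nn_integral_cong_simp)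
qed

text \<open>
  Averaging the weights: a mixture of the \<open>P \<theta>\<close> over \<open>\<tau>\<close> is a mixture of the \<open>Q i\<close> whose weight
  at \<open>i\<close> is the \<open>\<tau>\<close>-average of \<open>w \<theta> i\<close>, by exchanging sum and integral. These averaged weights
  are what all later arguments compare.
\<close>
lemma discrete_mixture_rep_mixing:
  assumes rep: "discrete_mixture_rep T S P I w Q"
    and w: "\<And>i. i \<in> I \<Longrightarrow> (\<lambda>\<theta>. w \<theta> i) \<in> borel_measurable T"
    and \<tau>: "prob_space \<tau>" "sets \<tau> = sets T"
  shows "\<exists>\<sigma>. prob_space \<sigma> \<and> sets \<sigma> = Pow I \<and>
    (\<forall>i\<in>I. emeasure \<sigma> {i} = (\<integral>\<^sup>+\<theta>. ennreal (w \<theta> i) \<partial>\<tau>)) \<and>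
    (\<forall>A\<in>sets S. (\<integral>\<^sup>+\<theta>. emeasure (P \<theta>) A \<partial>\<tau>) = (\<integral>\<^sup>+i. emeasure (Q i) A \<partial>\<sigma>))"
proof -
  define \<sigma> where "\<sigma> = density (count_space I) (\<lambda>i. \<integral>\<^sup>+\<theta>. ennreal (w \<theta> i) \<partial>\<tau>)"
  have [simp]: "space \<tau> = space T" using sets_eq_imp_space_eq[OF \<tau>(2)] .
  have [measurable]: "(\<lambda>\<theta>. w \<theta> i) \<in> borel_measurable \<tau>" if "i \<in> I" for i
    using w[OF that] \<tau>(2) by (simp cong: measurable_cong_sets)
  have I: "countable I" using rep by (simp add: discrete_mixture_rep_def)
  have mix: "(\<integral>\<^sup>+\<theta>. (\<integral>\<^sup>+i. ennreal (w \<theta> i) * f i \<partial>count_space I) \<partial>\<tau>) = (\<integral>\<^sup>+i. f i \<partial>\<sigma>)" for f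
  proof -
    have "(\<integral>\<^sup>+\<theta>. (\<integral>\<^sup>+i. ennreal (w \<theta> i) * f i \<partial>count_space I) \<partial>\<tau>)
       = (\<integral>\<^sup>+i. (\<integral>\<^sup>+\<theta>. ennreal (w \<theta> i) * f i \<partial>\<tau>) \<partial>count_space I)"
      using I by (intro nn_integral_count_space_nn_integral) auto
    also have "\<dots> = (\<integral>\<^sup>+i. f i \<partial>\<sigma>)"
      unfolding \<sigma>_def by (subst nn_integral_density) (auto intro!: nn_integral_cong simp: nn_integral_multc)
    finally show ?thesis .
  qed
  show ?thesis
  proof (intro exI[of _ \<sigma>] conjI ballI)
    show "sets \<sigma> = Pow I" by (simp add: \<sigma>_def)
    have "emeasure \<sigma> (space \<sigma>) = (\<integral>\<^sup>+i. 1 \<partial>\<sigma>)" by simp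
    also have "\<dots> = (\<integral>\<^sup>+\<theta>. (\<integral>\<^sup>+i. ennreal (w \<theta> i) * 1 \<partial>count_space I) \<partial>\<tau>)"
      by (rule mix[symmetric])
    also have "\<dots> = (\<integral>\<^sup>+\<theta>. 1 \<partial>\<tau>)"
    proof (intro nn_integral_cong)
      fix \<theta> assume "\<theta> \<in> space \<tau>"
      hence \<theta>: "\<theta> \<in> space T" by simp
      have P: "prob_space (P \<theta>)" "sets (P \<theta>) = sets S"
         and Q: "\<And>i. i \<in> I \<Longrightarrow> prob_space (Q i) \<and> sets (Q i) = sets S"
        using rep \<theta> by (auto simp: discrete_mixture_rep_def)
      have "(\<integral>\<^sup>+i. ennreal (w \<theta> i) * 1 \<partial>count_space I)
          = (\<integral>\<^sup>+i. ennreal (w \<theta> i) * emeasure (Q i) (space S) \<partial>count_space I)"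
      proof (intro nn_integral_cong)
        fix i assume "i \<in> space (count_space I)"
        hence "prob_space (Q i)" "space (Q i) = space S" using Q[of i] by (auto dest: sets_eq_imp_space_eq)
        from prob_space.emeasure_space_1[OF this(1)] this(2)
        show "ennreal (w \<theta> i) * 1 = ennreal (w \<theta> i) * emeasure (Q i) (space S)" by simp
      qed
      also have "\<dots> = emeasure (P \<theta>) (space S)"
        by (rule discrete_mixture_rep_emeasure[OF rep \<theta>, symmetric]) simp
      also have "\<dots> = 1"
        using prob_space.emeasure_space_1[OF P(1)] sets_eq_imp_space_eq[OF P(2)] by simp
      finally show "(\<integral>\<^sup>+i. ennreal (w \<theta> i) * 1 \<partial>count_space I) = 1" .
    qed
    also have "\<dots> = 1" using prob_space.emeasure_space_1[OF \<tau>(1)] by simp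
    finally show "prob_space \<sigma>" by (rule prob_spaceI)
    show "emeasure \<sigma> {i} = (\<integral>\<^sup>+\<theta>. ennreal (w \<theta> i) \<partial>\<tau>)" if "i \<in> I" for i
      using that unfolding \<sigma>_def
      by (subst emeasure_density) (auto simp: nn_integral_count_space_indicator nn_integral_indicator_singleton')
    show "(\<integral>\<^sup>+\<theta>. emeasure (P \<theta>) A \<partial>\<tau>) = (\<integral>\<^sup>+i. emeasure (Q i) A \<partial>\<sigma>)" if "A \<in> sets S" for A
      unfolding mix[symmetric]
      using discrete_mixture_rep_emeasure[OF rep _ that] by (intro nn_integral_cong) auto
  qed
qed

lemma Mix_subset_of_discrete_mixture_rep:
  assumes rep: "discrete_mixture_rep T S P I w Q"
    and w: "\<And>i. i \<in> I \<Longrightarrow> (\<lambda>\<theta>. w \<theta> i) \<in> borel_measurable T"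
  shows "Mix T S P \<subseteq> Mix (count_space I) S Q"
proof
  fix \<mu> assume "\<mu> \<in> Mix T S P"
  then obtain \<tau> where \<mu>: "prob_space \<mu>" "sets \<mu> = sets S" and \<tau>: "prob_space \<tau>" "sets \<tau> = sets T"
    and eq: "\<And>A. A \<in> sets S \<Longrightarrow> emeasure \<mu> A = (\<integral>\<^sup>+y. emeasure (P y) A \<partial>\<tau>)"
    unfolding Mix_def by blast
  show "\<mu> \<in> Mix (count_space I) S Q"
    using discrete_mixture_rep_mixing[OF rep w \<tau>] \<mu> eq unfolding Mix_def by fastforce
qed

section \<open>Central chi-squared distributions\<close>

definition chi_square_density :: "nat \<Rightarrow> real \<Rightarrow> real" where
  "chi_square_density m x =
     (if 0 < x
      then x powr (real m / 2 - 1) * exp (- x / 2) / (2 powr (real m / 2) * Gamma (real m / 2))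
      else 0)"

lemma chi_square_eq_density:
  "chi_square m = density lborel (\<lambda>x. ennreal (chi_square_density m x))"
  unfolding chi_square_def chi_square_density_def ..

lemma chi_square_density_nonneg [simp]: "0 \<le> chi_square_density m x"
  by (cases m) (auto simp: chi_square_density_def intro!: divide_nonneg_nonneg mult_nonneg_nonneg
      less_imp_le[OF Gamma_real_pos])

lemma borel_measurable_chi_square_density [measurable]:
  "chi_square_density m \<in> borel_measurable borel"
  unfolding chi_square_density_def[abs_def] by measurable

lemma sets_chi_square [simp, measurable_cong]: "sets (chi_square m) = sets borel"
  by (simp add: chi_square_def)

lemma space_chi_square [simp]: "space (chi_square m) = UNIV"
  by (simp add: chi_square_def)

lemma nn_integral_chi_square:
  assumes [measurable]: "f \<in> borel_measurable borel"
  shows "(\<integral>\<^sup>+x. f x \<partial>chi_square m) = (\<integral>\<^sup>+x. ennreal (chi_square_density m x) * f x \<partial>lborel)"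
  unfolding chi_square_eq_density by (subst nn_integral_density) auto

text \<open>
  This is the Laplace transform \<open>s \<mapsto> (1 + 2 * s) powr (- m / 2)\<close> in the parameter
  \<open>u = 1 / sqrt (1 + 2 * s)\<close>. In this parametrisation the transform of a mixture of chi-squared
  distributions is the power series whose coefficients are the mixing weights. At \<open>u = 1\<close> it
  gives the total mass.
\<close>
lemma chi_square_laplace:
  assumes m: "m \<ge> 1" and u: "u > 0"
  shows "(\<integral>\<^sup>+x. ennreal (exp (- ((1 / u\<^sup>2 - 1) / 2) * x)) \<partial>chi_square m) = ennreal (u ^ m)"
proof -
  define s where "s = real m / 2"
  \<comment> \<open>The exponentials merge into \<open>exp (- x / c)\<close>, and \<open>x = c * t\<close> leads to the integral of \<open>Gamma s\<close>.\<close>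
  define c where "c = 2 * u\<^sup>2"
  have s: "s > 0" and c: "c > 0" using m u by (auto simp: s_def c_def)
  have G: "Gamma s > 0" using s by (rule Gamma_real_pos)
  define K where "K = u ^ m / Gamma s"
  have K: "K \<ge> 0" using u G by (simp add: K_def)
  have cK: "c * (c powr (s - 1) / (2 powr s * Gamma s)) = K"
  proof -
    have "c * c powr (s - 1) = c powr s"
      using c by (simp add: powr_diff)
    also have "\<dots> = 2 powr s * (u\<^sup>2) powr s"
      unfolding c_def by (simp add: powr_mult)
    also have "(u\<^sup>2) powr s = u ^ m"
      using u by (simp add: powr_powr s_def powr_realpow flip: powr_numeral)
    finally show ?thesis by (simp add: K_def)
  qed
  have "(\<integral>\<^sup>+x. ennreal (exp (- ((1 / u\<^sup>2 - 1) / 2) * x)) \<partial>chi_square m)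
      = (\<integral>\<^sup>+x. ennreal (chi_square_density m x * exp (- ((1 / u\<^sup>2 - 1) / 2) * x)) \<partial>lborel)"
    by (subst nn_integral_chi_square) (auto simp: ennreal_mult)
  also have "\<dots> = (\<integral>\<^sup>+x. ennreal (indicator {0<..} x * x powr (s - 1) * exp (- x / c)
                          / (2 powr s * Gamma s)) \<partial>lborel)"
    by (intro nn_integral_cong arg_cong[where f = ennreal])
       (use u in \<open>auto simp: chi_square_density_def s_def[symmetric] c_def field_simps
          simp flip: exp_add\<close>)
  also have "\<dots> = ennreal \<bar>c\<bar> * (\<integral>\<^sup>+t. ennreal (indicator {0<..} (0 + c * t) * (0 + c * t) powr (s - 1)
                          * exp (- (0 + c * t) / c) / (2 powr s * Gamma s)) \<partial>lborel)"
    using c by (intro nn_integral_real_affine) auto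
  also have "\<dots> = (\<integral>\<^sup>+t. ennreal K * ennreal (indicator {0..} t * t powr (s - 1) / exp t) \<partial>lborel)"
    using c s G u unfolding cK[symmetric]
    by (subst nn_integral_cmult[symmetric], simp, intro nn_integral_cong)
       (auto simp: indicator_def ennreal_mult'[symmetric] powr_mult exp_minus zero_less_mult_iff
         divide_simps)
  also have "\<dots> = ennreal K * ennreal (Gamma s)"
    using s by (subst nn_integral_cmult) (auto simp: Gamma_conv_nn_integral_real)
  also have "\<dots> = ennreal (u ^ m)"
    using G u K by (simp add: K_def ennreal_mult'[symmetric])
  finally show ?thesis .
qed

lemma prob_space_chi_square: "m \<ge> 1 \<Longrightarrow> prob_space (chi_square m)"
  using chi_square_laplace[of m 1] by (intro prob_spaceI) simp

lemma chi_square_kernel: "chi_square \<in> count_space {1..} \<rightarrow>\<^sub>M prob_algebra borel"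
  by (auto simp: space_prob_algebra prob_space_chi_square)

text \<open>
  The convolution integral of the two densities is a Beta integral after rescaling \<open>y = x * t\<close>;
  the Gamma factors of the Beta function cancel against the normalising constants.
\<close>
lemma chi_square_convolution:
  assumes m: "m \<ge> 1" and l: "l \<ge> 1"
  shows "(chi_square m \<star> chi_square l) = chi_square (m + l)"
proof -
  define a where "a = real m / 2"
  define b where "b = real l / 2"
  have a: "a > 0" and b: "b > 0" using m l by (auto simp: a_def b_def)
  have G: "Gamma a > 0" "Gamma b > 0" "Gamma (a + b) > 0" using a b by (auto intro: Gamma_real_pos)
  have fin: "finite_measure (chi_square m)" "finite_measure (chi_square l)"
    using prob_space_chi_square[OF m] prob_space_chi_square[OF l]
    by (simp_all add: prob_space.finite_measure)
  have dens: "(\<integral>\<^sup>+y. ennreal (chi_square_density m (x - y)) * ennreal (chi_square_density l y) \<partial>lborel)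
      = ennreal (chi_square_density (m + l) x)" for x
  proof (cases "x > 0")
    case False
    hence "chi_square_density m (x - y) * chi_square_density l y = 0" for y
      by (auto simp: chi_square_density_def)
    hence "(\<integral>\<^sup>+y. ennreal (chi_square_density m (x - y)) * ennreal (chi_square_density l y) \<partial>lborel)
        = (\<integral>\<^sup>+y. 0 \<partial>(lborel :: real measure))"
      by (intro nn_integral_cong) (simp add: ennreal_mult'[symmetric] del: mult_eq_0_iff)
    thus ?thesis using False by (simp add: chi_square_density_def)
  next
    case True
    define D where "D = exp (- x / 2) / (2 powr (a + b) * (Gamma a * Gamma b))"
    define f where "f = (\<lambda>y. indicator {0<..<x} y * ((x - y) powr (a - 1) * y powr (b - 1)) * D)"
    have D: "D \<ge> 0" using G by (simp add: D_def)
    have eq: "chi_square_density m (x - y) * chi_square_density l y = f y" for y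
    proof (cases "y \<in> {0<..<x}")
      case True
      have e: "exp (- (x - y) / 2) * exp (- y / 2) = exp (- x / 2)"
        unfolding exp_add[symmetric] by (rule arg_cong[where f = exp]) (simp add: field_simps)
      have "chi_square_density m (x - y) * chi_square_density l y
          = (x - y) powr (a - 1) * y powr (b - 1) * (exp (- (x - y) / 2) * exp (- y / 2))
             / (2 powr (a + b) * (Gamma a * Gamma b))"
        using True by (simp add: chi_square_density_def a_def b_def powr_add add_divide_distrib ac_simps)
      thus ?thesis using True unfolding e by (simp add: f_def D_def)
    qed (auto simp: f_def chi_square_density_def)
    have "(\<integral>\<^sup>+y. ennreal (chi_square_density m (x - y)) * ennreal (chi_square_density l y) \<partial>lborel)
        = (\<integral>\<^sup>+y. ennreal (f y) \<partial>lborel)"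
      by (intro nn_integral_cong) (simp add: eq[symmetric] ennreal_mult)
    also have "\<dots> = ennreal \<bar>x\<bar> * (\<integral>\<^sup>+t. ennreal (f (0 + x * t)) \<partial>lborel)"
      using True by (intro nn_integral_real_affine) (auto simp: f_def)
    also have "\<dots> = (\<integral>\<^sup>+t. ennreal (x powr (a + b - 1) * D)
                 * ennreal (indicator {0..1} t * (t powr (b - 1) * (1 - t) powr (a - 1))) \<partial>lborel)"
    proof (subst nn_integral_cmult[symmetric], simp add: f_def, rule nn_integral_cong)
      fix t :: real
      show "ennreal \<bar>x\<bar> * ennreal (f (0 + x * t)) = ennreal (x powr (a + b - 1) * D)
               * ennreal (indicator {0..1} t * (t powr (b - 1) * (1 - t) powr (a - 1)))"
      proof (cases "0 < t \<and> t < 1")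
        case t: True
        have "x - x * t = x * (1 - t)" by (simp add: algebra_simps)
        hence "(x - x * t) powr (a - 1) * (x * t) powr (b - 1)
            = x powr (a - 1) * x powr (b - 1) * ((1 - t) powr (a - 1) * t powr (b - 1))"
          using True t by (simp add: powr_mult)
        moreover have "x * (x powr (a - 1) * x powr (b - 1)) = x powr (a + b - 1)"
          using True by (simp add: powr_diff powr_add)
        ultimately show ?thesis using True t D
          by (simp add: f_def ennreal_mult'[symmetric] ac_simps)
      next
        case False
        \<comment> \<open>At the end points both sides vanish because \<open>0 powr y = 0\<close>.\<close>
        hence "t < 0 \<or> t = 0 \<or> t = 1 \<or> t > 1" by linarith
        with True show ?thesis
          by (auto simp: f_def indicator_def mult_less_0_iff zero_less_mult_iff)
      qed
    qed
    also have "\<dots> = ennreal (x powr (a + b - 1) * D) * ennreal (Beta b a)"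
      by (subst nn_integral_cmult, simp, subst nn_integral_has_integral_lebesgue[OF _ has_integral_Beta_real[OF b a]])
         auto
    also have "\<dots> = ennreal (chi_square_density (m + l) x)"
      using True G D
      by (subst ennreal_mult'[symmetric], simp)
         (simp add: chi_square_density_def D_def Beta_def add_divide_distrib a_def b_def add_ac)
    finally show ?thesis .
  qed
  show ?thesis
    unfolding chi_square_eq_density
    by (subst convolution_density) (use fin in \<open>auto simp: dens chi_square_eq_density\<close>)
qed

text \<open>
  The substitution rule for compact intervals, exhausted by \<open>{0..n}\<close> and monotone convergence.
\<close>
lemma nn_integral_square_substitution:
  fixes f :: "real \<Rightarrow> real"
  assumes [measurable]: "f \<in> borel_measurable borel" and nonneg: "\<And>x. 0 \<le> f x"
  shows "(\<integral>\<^sup>+x. f x * indicator {0..} x \<partial>lborel)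
       = (\<integral>\<^sup>+x. f (x\<^sup>2) * (2 * x) * indicator {0..} x \<partial>lborel)"
proof -
  have deriv: "((\<lambda>x. x\<^sup>2) has_real_derivative 2 * x) (at x)" for x :: real
    by (auto intro!: derivative_eq_intros)
  have "(\<integral>\<^sup>+x. f x * indicator {0..} x \<partial>lborel)
      = (\<integral>\<^sup>+x. (SUP n. ennreal (f x * indicator {0..(real n)\<^sup>2} x)) \<partial>lborel)"
  proof (intro nn_integral_cong)
    fix x :: real
    obtain n where "sqrt x \<le> real n" using real_arch_simple by blast
    hence n: "x \<le> (real n)\<^sup>2" using sqrt_le_D by blast
    have "(SUP n. ennreal (f x * indicator {0..(real n)\<^sup>2} x)) = ennreal (f x * indicator {0..} x)"
      using n nonneg[of x] by (intro antisym SUP_least SUP_upper2[of n]) (auto simp: indicator_def)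
    thus "ennreal (f x * indicator {0..} x) = (SUP n. ennreal (f x * indicator {0..(real n)\<^sup>2} x))" ..
  qed
  also have "\<dots> = (SUP n. \<integral>\<^sup>+x. ennreal (f x * indicator {0..(real n)\<^sup>2} x) \<partial>lborel)"
  proof (intro nn_integral_monotone_convergence_SUP)
    have "(real m)\<^sup>2 \<le> (real n)\<^sup>2" if "m \<le> n" for m n using that by (intro power_mono) auto
    thus "incseq (\<lambda>n x. ennreal (f x * indicator {0..(real n)\<^sup>2} x))"
      using nonneg by (auto simp: incseq_def le_fun_def indicator_def intro: order_trans)
  qed simp
  also have "\<dots> = (SUP n. \<integral>\<^sup>+x. ennreal (f (x\<^sup>2) * (2 * x) * indicator {0..real n} x) \<partial>lborel)"
  proof (intro SUP_cong refl)
    fix n :: nat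
    show "(\<integral>\<^sup>+x. ennreal (f x * indicator {0..(real n)\<^sup>2} x) \<partial>lborel)
        = (\<integral>\<^sup>+x. ennreal (f (x\<^sup>2) * (2 * x) * indicator {0..real n} x) \<partial>lborel)"
      using nn_integral_substitution[of "\<lambda>x. x\<^sup>2" 0 "real n" f "\<lambda>x. 2 * x", OF _ deriv]
      by (auto intro!: continuous_intros simp: set_borel_measurable_def)
  qed
  also have "\<dots> = (\<integral>\<^sup>+x. (SUP n. ennreal (f (x\<^sup>2) * (2 * x) * indicator {0..real n} x)) \<partial>lborel)"
  proof (intro nn_integral_monotone_convergence_SUP[symmetric])
    show "incseq (\<lambda>n x. ennreal (f (x\<^sup>2) * (2 * x) * indicator {0..real n} x))"
      using nonneg by (auto simp: incseq_def le_fun_def indicator_def)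
  qed simp
  also have "\<dots> = (\<integral>\<^sup>+x. f (x\<^sup>2) * (2 * x) * indicator {0..} x \<partial>lborel)"
  proof (intro nn_integral_cong)
    fix x :: real
    obtain n where "x \<le> real n" using real_arch_simple by blast
    thus "(SUP n. ennreal (f (x\<^sup>2) * (2 * x) * indicator {0..real n} x)) = ennreal (f (x\<^sup>2) * (2 * x) * indicator {0..} x)"
      using nonneg[of "x\<^sup>2"] by (intro antisym SUP_least SUP_upper2[of n]) (auto simp: indicator_def)
  qed
  finally show ?thesis .
qed

text \<open>
  The chi-squared law in the coordinate \<open>sqrt x\<close>, in which it can be compared with normal
  densities.
\<close>
lemma emeasure_chi_square_sqrt_coordinate:
  assumes [measurable]: "A \<in> sets borel"
  shows "emeasure (chi_square m) A
    = (\<integral>\<^sup>+x. ennreal (chi_square_density m (x\<^sup>2) * (2 * x)) * indicator {0<..} x * indicator A (x\<^sup>2) \<partial>lborel)"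
proof -
  have "emeasure (chi_square m) A = (\<integral>\<^sup>+x. ennreal (chi_square_density m x * indicator A x * indicator {0..} x) \<partial>lborel)"
    unfolding chi_square_eq_density
    by (subst emeasure_density) (auto intro!: nn_integral_cong simp: indicator_def chi_square_density_def)
  also have "\<dots> = (\<integral>\<^sup>+x. ennreal (chi_square_density m (x\<^sup>2) * indicator A (x\<^sup>2) * (2 * x) * indicator {0..} x) \<partial>lborel)"
    by (subst nn_integral_square_substitution) auto
  also have "\<dots> = (\<integral>\<^sup>+x. ennreal (chi_square_density m (x\<^sup>2) * (2 * x)) * indicator {0<..} x * indicator A (x\<^sup>2) \<partial>lborel)"
    by (intro nn_integral_cong) (auto simp: indicator_def)
  finally show ?thesis .
qed

section \<open>Identifiability of mixtures of central chi-squared distributions\<close>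

text \<open>
  At the first index \<open>n\<close> at which the coefficients differ, their difference would be the limit,
  as \<open>u\<close> decreases to \<open>0\<close>, of the difference of the two series divided by \<open>u ^ n\<close>, which is \<open>0\<close>.
\<close>
lemma powser_coeff_unique_on_unit_interval:
  fixes a b :: "nat \<Rightarrow> real"
  assumes "\<And>u. 0 < u \<Longrightarrow> u < 1 \<Longrightarrow> (\<lambda>n. a n * u ^ n) sums f u"
    and "\<And>u. 0 < u \<Longrightarrow> u < 1 \<Longrightarrow> (\<lambda>n. b n * u ^ n) sums f u"
  shows "a = b"
proof
  fix n
  define c where "c = (\<lambda>n. a n - b n)"
  have c: "(\<lambda>n. c n * u ^ n) sums 0" if "0 < u" "u < 1" for u
    using sums_diff[OF assms(1)[OF that] assms(2)[OF that]] by (simp add: c_def algebra_simps)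
  have "c n = 0"
  proof (induction n rule: less_induct)
    case (less n)
    have shift: "(\<lambda>k. c (k + n) * u ^ k) sums 0" if u: "0 < u" "u < 1" for u
    proof -
      have "(\<Sum>i<n. c i * u ^ i) = 0" using less by simp
      hence "(\<lambda>k. c (k + n) * u ^ (k + n)) sums 0"
        using c[OF u] sums_iff_shift[of "\<lambda>k. c k * u ^ k" n 0] by simp
      hence "(\<lambda>k. (c (k + n) * u ^ (k + n)) * (1 / u ^ n)) sums (0 * (1 / u ^ n))"
        by (rule sums_mult2)
      thus ?thesis using u by (simp add: power_add)
    qed
    define g where "g = (\<lambda>u. \<Sum>k. c (k + n) * u ^ k)"
    have "(\<lambda>k. c (k + n) * u ^ k) sums g u" if "norm u < 1 / 2" for u
    proof -
      have "summable (\<lambda>k. c (k + n) * (1 / 2) ^ k)"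
        using shift[of "1 / 2"] by (simp add: sums_iff)
      hence "summable (\<lambda>k. c (k + n) * u ^ k)"
        by (rule powser_inside) (use that in simp)
      thus ?thesis unfolding g_def by (rule summable_sums)
    qed
    \<comment> \<open>A two-sided limit at \<open>0\<close> needs the shifted series on both sides of it; the radius 1/2
      makes its convergence a consequence of that at \<open>u = 1 / 2\<close>.\<close>
    from powser_limit_0[of "1 / 2" "\<lambda>k. c (k + n)" g, OF _ this]
    have "(g \<longlongrightarrow> c (0 + n)) (at 0)" by simp
    hence "(g \<longlongrightarrow> c n) (at_right 0)" by (simp add: filterlim_at_split)
    moreover have "\<forall>\<^sub>F u in at_right 0. g u = 0"
      using eventually_at_right_real[of 0 "1::real", OF zero_less_one]
      by eventually_elim (use shift in \<open>auto simp: g_def sums_iff\<close>)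
    hence "(g \<longlongrightarrow> 0) (at_right 0)" by (rule tendsto_eventually)
    ultimately show ?case by (intro tendsto_unique[of "at_right (0::real)" g]) auto
  qed
  thus "a n = b n" by (simp add: c_def)
qed

text \<open>
  The right-hand side depends on \<open>\<mu>\<close> alone, so two mixing measures of the same \<open>\<mu>\<close> have the same
  generating function. The index \<open>0\<close> lies outside the index set and gets coefficient \<open>0\<close>.
\<close>
lemma chi_square_mixture_laplace:
  assumes \<sigma>: "prob_space \<sigma>" "sets \<sigma> = Pow {1..}" and \<mu>: "sets \<mu> = sets borel"
    and eq: "\<And>A. A \<in> sets borel \<Longrightarrow> emeasure \<mu> A = (\<integral>\<^sup>+k. emeasure (chi_square k) A \<partial>\<sigma>)"
    and u: "0 < u" "u < 1"
  shows "(\<lambda>k. (if k \<ge> 1 then measure \<sigma> {k} else 0) * u ^ k) sums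
    enn2real (\<integral>\<^sup>+x. ennreal (exp (- ((1 / u\<^sup>2 - 1) / 2) * x)) \<partial>\<mu>)"
proof -
  interpret prob_space \<sigma> by fact
  have sp: "space \<sigma> = {1..}" using sets_eq_imp_space_eq[of \<sigma> "count_space {1..}"] \<sigma> by simp
  let ?a = "\<lambda>k. if k \<ge> 1 then measure \<sigma> {k} else 0"
  have "(\<integral>\<^sup>+x. ennreal (exp (- ((1 / u\<^sup>2 - 1) / 2) * x)) \<partial>\<mu>)
     = (\<integral>\<^sup>+k. \<integral>\<^sup>+x. ennreal (exp (- ((1 / u\<^sup>2 - 1) / 2) * x)) \<partial>chi_square k \<partial>\<sigma>)"
    using measurable_prob_algebraD[OF chi_square_kernel]
    by (intro nn_integral_mixture[where S = borel] eq \<mu>)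
       (simp_all add: sp measurable_cong_sets[of \<sigma> "count_space {1..}"] \<sigma>(2))
  also have "\<dots> = (\<integral>\<^sup>+k. ennreal (u ^ k) \<partial>\<sigma>)"
    using u by (intro nn_integral_cong chi_square_laplace) (auto simp: sp)
  also have "\<dots> = (\<integral>\<^sup>+k. ennreal (u ^ k) \<partial>density (count_space {1..}) (\<lambda>k. emeasure \<sigma> {k}))"
    using \<sigma>(2) by (subst density_count_space_singletons) auto
  also have "\<dots> = (\<integral>\<^sup>+k. emeasure \<sigma> {k} * ennreal (u ^ k) \<partial>count_space {1..})"
    by (subst nn_integral_density) auto
  also have "\<dots> = (\<integral>\<^sup>+k. ennreal (?a k * u ^ k) \<partial>count_space UNIV)"
    using u by (subst nn_integral_count_space_indicator)
       (auto intro!: nn_integral_cong simp: indicator_def emeasure_eq_measure ennreal_mult)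
  also have "\<dots> = (\<Sum>k. ennreal (?a k * u ^ k))"
    by (rule nn_integral_count_space_nat)
  finally have sum: "(\<integral>\<^sup>+x. ennreal (exp (- ((1 / u\<^sup>2 - 1) / 2) * x)) \<partial>\<mu>) = (\<Sum>k. ennreal (?a k * u ^ k))" .
  have "summable (\<lambda>k. ?a k * u ^ k)"
  proof (rule summable_comparison_test)
    show "\<exists>N. \<forall>k\<ge>N. norm (?a k * u ^ k) \<le> u ^ k"
      using u by (auto intro!: exI[of _ 0] mult_left_le_one_le simp: abs_mult)
    show "summable (\<lambda>k. u ^ k)" using u by (intro summable_geometric) simp
  qed
  moreover have nonneg: "0 \<le> ?a k * u ^ k" for k using u by simp
  ultimately show ?thesis
    unfolding sum using suminf_nonneg[OF _ nonneg]
    by (subst suminf_ennreal2) (simp_all add: summable_sums)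
qed

lemma chi_square_mixture_unique:
  assumes \<sigma>: "prob_space \<sigma>" "sets \<sigma> = Pow {1..}" and \<sigma>': "prob_space \<sigma>'" "sets \<sigma>' = Pow {1..}"
    and eq: "\<And>A. A \<in> sets borel \<Longrightarrow>
      (\<integral>\<^sup>+k. emeasure (chi_square k) A \<partial>\<sigma>) = (\<integral>\<^sup>+k. emeasure (chi_square k) A \<partial>\<sigma>')"
  shows "\<sigma> = \<sigma>'"
proof (rule measure_eqI_countable[of _ "{1::nat..}"])
  fix k :: nat assume k: "k \<in> {1..}"
  have \<sigma>_alg: "\<sigma> \<in> space (prob_algebra (count_space {1..}))" using \<sigma> by (simp add: space_prob_algebra)
  let ?\<mu> = "\<sigma> \<bind> chi_square"
  have e: "emeasure ?\<mu> A = (\<integral>\<^sup>+k. emeasure (chi_square k) A \<partial>\<sigma>)" if "A \<in> sets borel" for A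
    by (rule emeasure_bind_prob_algebra[OF \<sigma>_alg chi_square_kernel that])
  have s: "sets ?\<mu> = sets borel" by (rule sets_bind'[OF \<sigma>_alg chi_square_kernel])
  have "(\<lambda>k. if k \<ge> 1 then measure \<sigma> {k} else 0) = (\<lambda>k. if k \<ge> 1 then measure \<sigma>' {k} else 0)"
  proof (rule powser_coeff_unique_on_unit_interval)
    fix u :: real assume u: "0 < u" "u < 1"
    show "(\<lambda>k. (if k \<ge> 1 then measure \<sigma> {k} else 0) * u ^ k) sums
      enn2real (\<integral>\<^sup>+x. ennreal (exp (- ((1 / u\<^sup>2 - 1) / 2) * x)) \<partial>?\<mu>)"
      by (rule chi_square_mixture_laplace[OF \<sigma> s e u])
    show "(\<lambda>k. (if k \<ge> 1 then measure \<sigma>' {k} else 0) * u ^ k) sums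
      enn2real (\<integral>\<^sup>+x. ennreal (exp (- ((1 / u\<^sup>2 - 1) / 2) * x)) \<partial>?\<mu>)"
      by (rule chi_square_mixture_laplace[OF \<sigma>' s _ u]) (simp add: e eq)
  qed
  from fun_cong[OF this, of k] k show "emeasure \<sigma> {k} = emeasure \<sigma>' {k}"
    using \<sigma> \<sigma>' by (simp add: finite_measure.emeasure_eq_measure prob_space.finite_measure)
qed (simp_all add: \<sigma> \<sigma>')

section \<open>Noncentral chi-squared distributions as Poisson mixtures\<close>

lemma poisson_mass_nonneg [simp]: "l \<ge> 0 \<Longrightarrow> 0 \<le> poisson_mass l k"
  by (simp add: poisson_mass_def)

lemma Gamma_nat_plus_half: "Gamma (real k + 1 / 2) = fact (2 * k) * sqrt pi / (4 ^ k * fact k)"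
proof (induction k)
  case 0
  show ?case by (simp add: Gamma_one_half_real)
next
  case (Suc k)
  have "real k + 1 / 2 \<notin> \<int>\<^sub>\<le>\<^sub>0" by (auto elim!: nonpos_Ints_cases simp: field_simps)
  hence "Gamma (real (Suc k) + 1 / 2) = (real k + 1 / 2) * Gamma (real k + 1 / 2)"
    using Gamma_plus1[of "real k + 1 / 2"] by (simp add: add_ac)
  also have "\<dots> = fact (2 * Suc k) * sqrt pi / (4 ^ Suc k * fact (Suc k))"
    unfolding Suc.IH by (simp add: divide_simps) (simp add: algebra_simps)
  finally show ?case .
qed

text \<open>
  The two densities are \<open>std_normal_density x * exp (- a\<^sup>2 / 2)\<close> times \<open>exp (a * x)\<close> and
  \<open>exp (- (a * x))\<close>, so they add up to a multiple of \<open>cosh (a * x)\<close>. Only even powers occur in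
  its series, and by the value of Gamma at half-integers the \<open>k\<close>-th term is a Poisson weight
  times the density of the square root of a chi-squared variable with \<open>2 * k + 1\<close> degrees of
  freedom.
\<close>
lemma shifted_normal_density_series:
  assumes x: "x > 0"
  shows "(\<lambda>k. poisson_mass (a\<^sup>2 / 2) k * (chi_square_density (2 * k + 1) (x\<^sup>2) * (2 * x)))
     sums (std_normal_density (x - a) + std_normal_density (x + a))"
proof -
  define C where "C = 2 * std_normal_density x * exp (- a\<^sup>2 / 2)"
  have "(\<lambda>n. if even n then (a * x) ^ n /\<^sub>R fact n else 0) sums cosh (a * x)"
    by (rule cosh_converges)
  hence "(\<lambda>k. (a * x) ^ (2 * k) /\<^sub>R fact (2 * k)) sums cosh (a * x)"
    by (subst (asm) sums_mono_reindex[of "\<lambda>k. 2 * k", symmetric])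
       (auto simp: strict_mono_def elim!: evenE)
  hence "(\<lambda>k. C * ((a * x) ^ (2 * k) /\<^sub>R fact (2 * k))) sums (C * cosh (a * x))"
    by (rule sums_mult)
  moreover have "C * ((a * x) ^ (2 * k) /\<^sub>R fact (2 * k))
      = poisson_mass (a\<^sup>2 / 2) k * (chi_square_density (2 * k + 1) (x\<^sup>2) * (2 * x))" for k
  proof -
    have p1: "(x\<^sup>2) powr (real (2 * k + 1) / 2 - 1) * x = x ^ (2 * k)"
    proof -
      have "(x\<^sup>2) powr (real (2 * k + 1) / 2 - 1) = x powr (2 * (real (2 * k + 1) / 2 - 1))"
        using x by (simp add: powr_powr flip: powr_numeral)
      also have "2 * (real (2 * k + 1) / 2 - 1) = real (2 * k) - 1"
        by (simp add: field_simps)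
      also have "x powr (real (2 * k) - 1) = x ^ (2 * k) / x"
        unfolding powr_diff using x by (simp add: powr_realpow del: of_nat_mult)
      finally show ?thesis using x by simp
    qed
    have p2: "2 powr (real (2 * k + 1) / 2) = 2 ^ k * sqrt 2"
      by (simp add: add_divide_distrib powr_add powr_realpow powr_half_sqrt)
    have p3: "Gamma (real (2 * k + 1) / 2) = fact (2 * k) * sqrt pi / (4 ^ k * fact k)"
      using Gamma_nat_plus_half[of k] by (simp add: add_divide_distrib add.commute)
    have "poisson_mass (a\<^sup>2 / 2) k * (chi_square_density (2 * k + 1) (x\<^sup>2) * (2 * x))
      = 2 * ((a\<^sup>2 / 2) ^ k / fact k * exp (- a\<^sup>2 / 2)) * ((x\<^sup>2) powr (real (2 * k + 1) / 2 - 1) * x)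
         * exp (- x\<^sup>2 / 2) / (2 powr (real (2 * k + 1) / 2) * Gamma (real (2 * k + 1) / 2))"
      using x by (simp add: poisson_mass_def chi_square_density_def)
    also have "\<dots> = 2 * ((a\<^sup>2 / 2) ^ k / fact k * exp (- a\<^sup>2 / 2)) * x ^ (2 * k)
         * exp (- x\<^sup>2 / 2) / ((2 ^ k * sqrt 2) * (fact (2 * k) * sqrt pi / (4 ^ k * fact k)))"
      unfolding p1 p2 p3 ..
    also have "\<dots> = C * ((a * x) ^ (2 * k) /\<^sub>R fact (2 * k))"
    proof -
      have "(4::real) ^ k = 2 ^ k * 2 ^ k" by (simp flip: power_mult_distrib)
      thus ?thesis
        by (simp add: C_def std_normal_density_def power_divide real_sqrt_mult power_mult_distrib
            power_mult divide_simps)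
    qed
    finally show ?thesis ..
  qed
  moreover have "C * cosh (a * x) = std_normal_density (x - a) + std_normal_density (x + a)"
  proof -
    have e: "exp (- (x - a)\<^sup>2 / 2) = exp (- x\<^sup>2 / 2) * exp (- a\<^sup>2 / 2) * exp (a * x)"
       "exp (- (x + a)\<^sup>2 / 2) = exp (- x\<^sup>2 / 2) * exp (- a\<^sup>2 / 2) * exp (- (a * x))"
      unfolding exp_add[symmetric]
      by (rule arg_cong[where f = exp], simp add: power2_eq_square field_simps)+
    show ?thesis
      unfolding C_def std_normal_density_def e cosh_def by (simp add: field_simps)
  qed
  ultimately show ?thesis by simp
qed

text \<open>
  Folding the negative half-line onto the positive one makes the two densities of the series
  above appear.
\<close>
lemma emeasure_shifted_normal_square:
  assumes [measurable]: "A \<in> sets borel"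
  shows "(\<integral>\<^sup>+z. indicator A ((z + a)\<^sup>2) \<partial>std_normal_distribution)
    = (\<Sum>k. ennreal (poisson_mass (a\<^sup>2 / 2) k) * emeasure (chi_square (2 * k + 1)) A)"
proof -
  let ?\<phi> = "std_normal_density"
  let ?I = "\<lambda>x::real. indicator A (x\<^sup>2) :: ennreal"
  have "(\<integral>\<^sup>+z. indicator A ((z + a)\<^sup>2) \<partial>std_normal_distribution)
      = (\<integral>\<^sup>+z. ennreal (?\<phi> z) * indicator A ((z + a)\<^sup>2) \<partial>lborel)"
    by (subst nn_integral_density) auto
  also have "\<dots> = ennreal \<bar>1\<bar> * (\<integral>\<^sup>+x. ennreal (?\<phi> (- a + 1 * x)) * indicator A (((- a + 1 * x) + a)\<^sup>2) \<partial>lborel)"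
    by (rule nn_integral_real_affine) auto
  also have "\<dots> = (\<integral>\<^sup>+x. ennreal (?\<phi> (x - a)) * ?I x \<partial>lborel)"
    by simp
  also have "\<dots> = (\<integral>\<^sup>+x. ennreal (?\<phi> (x - a)) * ?I x * indicator {0<..} x
                 + ennreal (?\<phi> (x - a)) * ?I x * indicator {..<0} x \<partial>lborel)"
  proof (intro nn_integral_cong_AE)
    show "AE x in lborel. ennreal (?\<phi> (x - a)) * ?I x = ennreal (?\<phi> (x - a)) * ?I x * indicator {0<..} x
                 + ennreal (?\<phi> (x - a)) * ?I x * indicator {..<0} x"
      using AE_lborel_singleton[of "0::real"] by eventually_elim (auto simp: indicator_def)
  qed
  also have "\<dots> = (\<integral>\<^sup>+x. ennreal (?\<phi> (x - a)) * ?I x * indicator {0<..} x \<partial>lborel)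
                 + (\<integral>\<^sup>+x. ennreal (?\<phi> (x - a)) * ?I x * indicator {..<0} x \<partial>lborel)"
    by (intro nn_integral_add) auto
  also have "(\<integral>\<^sup>+x. ennreal (?\<phi> (x - a)) * ?I x * indicator {..<0} x \<partial>lborel)
     = ennreal \<bar>- 1\<bar> * (\<integral>\<^sup>+x. ennreal (?\<phi> ((0 + (- 1) * x) - a)) * ?I (0 + (- 1) * x)
          * indicator {..<0} (0 + (- 1) * x) \<partial>lborel)"
    by (rule nn_integral_real_affine) auto
  also have "\<dots> = (\<integral>\<^sup>+x. ennreal (?\<phi> (x + a)) * ?I x * indicator {0<..} x \<partial>lborel)"
    by (auto intro!: nn_integral_cong simp: indicator_def std_normal_density_def power2_eq_square algebra_simps)
  also have "(\<integral>\<^sup>+x. ennreal (?\<phi> (x - a)) * ?I x * indicator {0<..} x \<partial>lborel) + \<dots>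
      = (\<integral>\<^sup>+x. ennreal (?\<phi> (x - a) + ?\<phi> (x + a)) * ?I x * indicator {0<..} x \<partial>lborel)"
    by (subst nn_integral_add[symmetric]) (auto intro!: nn_integral_cong simp: distrib_right)
  also have "\<dots> = (\<integral>\<^sup>+x. (\<Sum>k. ennreal (poisson_mass (a\<^sup>2 / 2) k) *
      (ennreal (chi_square_density (2 * k + 1) (x\<^sup>2) * (2 * x)) * indicator {0<..} x * ?I x)) \<partial>lborel)"
  proof (intro nn_integral_cong)
    fix x :: real
    show "ennreal (?\<phi> (x - a) + ?\<phi> (x + a)) * ?I x * indicator {0<..} x
      = (\<Sum>k. ennreal (poisson_mass (a\<^sup>2 / 2) k) *
          (ennreal (chi_square_density (2 * k + 1) (x\<^sup>2) * (2 * x)) * indicator {0<..} x * ?I x))"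
    proof (cases "x > 0")
      case True
      have "ennreal (?\<phi> (x - a) + ?\<phi> (x + a))
          = (\<Sum>k. ennreal (poisson_mass (a\<^sup>2 / 2) k * (chi_square_density (2 * k + 1) (x\<^sup>2) * (2 * x))))"
        using True by (intro suminf_ennreal_eq[OF _ shifted_normal_density_series, symmetric]) auto
      thus ?thesis using True by (simp add: indicator_def ennreal_mult)
    qed simp
  qed
  also have "\<dots> = (\<Sum>k. ennreal (poisson_mass (a\<^sup>2 / 2) k) * emeasure (chi_square (2 * k + 1)) A)"
    by (subst nn_integral_suminf)
       (auto simp: nn_integral_cmult emeasure_chi_square_sqrt_coordinate)
  finally show ?thesis .
qed

text \<open>
  Induction on the dimension. The shift is confined to coordinate \<open>0\<close>, so it is met only in the
  one-dimensional base case; every further coordinate adds the square of an independent standard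
  normal variable, that is, it convolves each component with \<open>chi_square 1\<close>.
\<close>
lemma emeasure_noncentral_chi_square:
  assumes "n \<ge> 1" and \<theta>: "\<theta> \<ge> 0" and [measurable]: "A \<in> sets borel"
  shows "emeasure (noncentral_chi_square n \<theta>) A
    = (\<Sum>k. ennreal (poisson_mass (\<theta> / 2) k) * emeasure (chi_square (2 * k + n)) A)"
proof -
  let ?N = "std_normal_distribution :: real measure"
  interpret N: prob_space ?N by (rule prob_space_normal_density) simp
  interpret product_sigma_finite "\<lambda>_::nat. ?N" by standard
  define S where "S = (\<lambda>(n::nat) z. \<Sum>i<n. (z i + (if i = 0 then sqrt \<theta> else 0))\<^sup>2 :: real)"
  have S [measurable]: "S n \<in> borel_measurable (\<Pi>\<^sub>M i\<in>{..<n}. ?N)" for n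
  proof -
    have [measurable]: "(\<lambda>z. z i) \<in> borel_measurable (\<Pi>\<^sub>M i\<in>{..<n}. ?N)" if "i < n" for i
      using measurable_component_singleton[of i "{..<n}" "\<lambda>_. ?N"] that
      by (auto cong: measurable_cong_sets)
    show ?thesis
      unfolding S_def by (intro borel_measurable_sum borel_measurable_power borel_measurable_add) auto
  qed
  have nc: "noncentral_chi_square n \<theta> = distr (\<Pi>\<^sub>M i\<in>{..<n}. ?N) borel (S n)" for n
    by (simp add: noncentral_chi_square_def S_def)
  have S0: "S 0 z = 0" for z by (simp add: S_def)
  have emeasure_S: "emeasure (noncentral_chi_square n \<theta>) A
      = (\<integral>\<^sup>+z. indicator A (S n z) \<partial>(\<Pi>\<^sub>M i\<in>{..<n}. ?N))" if [measurable]: "A \<in> sets borel" for A n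
    unfolding nc
    by (subst nn_integral_indicator[symmetric], simp, subst nn_integral_distr) auto
  have step: "(\<integral>\<^sup>+z. indicator A (S (Suc n) z) \<partial>(\<Pi>\<^sub>M i\<in>{..<Suc n}. ?N))
     = (\<integral>\<^sup>+z. \<integral>\<^sup>+y. indicator A (S n z + (y + (if n = 0 then sqrt \<theta> else 0))\<^sup>2) \<partial>?N \<partial>(\<Pi>\<^sub>M i\<in>{..<n}. ?N))"
    if [measurable]: "A \<in> sets borel" for A n
  proof -
    have "(\<integral>\<^sup>+z. indicator A (S (Suc n) z) \<partial>(\<Pi>\<^sub>M i\<in>insert n {..<n}. ?N))
      = (\<integral>\<^sup>+z. \<integral>\<^sup>+y. indicator A (S (Suc n) (z(n := y))) \<partial>?N \<partial>(\<Pi>\<^sub>M i\<in>{..<n}. ?N))"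
      using S[of "Suc n"] by (intro product_nn_integral_insert) (auto simp: lessThan_Suc)
    moreover have "S (Suc n) (z(n := y)) = S n z + (y + (if n = 0 then sqrt \<theta> else 0))\<^sup>2" for z y
      by (simp add: S_def)
    ultimately show ?thesis by (simp add: lessThan_Suc)
  qed
  show ?thesis using \<open>n \<ge> 1\<close> \<open>A \<in> sets borel\<close>
  proof (induction n arbitrary: A rule: nat_induct_at_least)
    case base
    hence [measurable]: "A \<in> sets borel" .
    interpret P0: prob_space "\<Pi>\<^sub>M i\<in>{..<0::nat}. ?N" by (intro prob_space_PiM) (rule N.prob_space_axioms)
    have "emeasure (noncentral_chi_square 1 \<theta>) A
        = (\<integral>\<^sup>+z. \<integral>\<^sup>+y. indicator A ((y + sqrt \<theta>)\<^sup>2) \<partial>?N \<partial>(\<Pi>\<^sub>M i\<in>{..<0::nat}. ?N))"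
      using step[of A 0] by (simp add: emeasure_S S0)
    thus ?case using emeasure_shifted_normal_square[of A "sqrt \<theta>"] \<theta>
      by (simp add: P0.emeasure_space_1 del: lessThan_0)
  next
    case (Suc n)
    hence [measurable]: "A \<in> sets borel" by simp
    \<comment> \<open>The one-dimensional case without shift: only the term \<open>k = 0\<close> of the Poisson series survives.\<close>
    have sq: "(\<integral>\<^sup>+y. indicator A (x + y\<^sup>2) \<partial>?N) = emeasure (chi_square 1) {y. x + y \<in> A}" for x
    proof -
      have [measurable]: "{y. x + y \<in> A} \<in> sets borel" by measurable
      have "(\<integral>\<^sup>+y. indicator A (x + y\<^sup>2) \<partial>?N) = (\<integral>\<^sup>+y. indicator {y. x + y \<in> A} ((y + 0)\<^sup>2) \<partial>?N)"
        by (intro nn_integral_cong) (auto simp: indicator_def)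
      also have "\<dots> = (\<Sum>k. ennreal (poisson_mass 0 k) * emeasure (chi_square (2 * k + 1)) {y. x + y \<in> A})"
        by (subst emeasure_shifted_normal_square) auto
      also have "\<dots> = (\<Sum>k\<in>{0}. ennreal (poisson_mass 0 k) * emeasure (chi_square (2 * k + 1)) {y. x + y \<in> A})"
        by (intro suminf_finite) (auto simp: poisson_mass_def)
      finally show ?thesis by (simp add: poisson_mass_def)
    qed
    have "(\<lambda>x. \<integral>\<^sup>+y. indicator A (x + y\<^sup>2) \<partial>?N) \<in> borel_measurable borel"
      by measurable
    hence [measurable]: "(\<lambda>x. emeasure (chi_square 1) {y. x + y \<in> A}) \<in> borel_measurable borel"
      unfolding sq .
    have "emeasure (noncentral_chi_square (Suc n) \<theta>) A
       = (\<integral>\<^sup>+z. emeasure (chi_square 1) {y. S n z + y \<in> A} \<partial>(\<Pi>\<^sub>M i\<in>{..<n}. ?N))"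
      using \<open>n \<ge> 1\<close> by (simp add: emeasure_S step sq)
    also have "\<dots> = (\<integral>\<^sup>+x. emeasure (chi_square 1) {y. x + y \<in> A} \<partial>noncentral_chi_square n \<theta>)"
      unfolding nc by (subst nn_integral_distr) (simp_all del: One_nat_def)
    also have "\<dots> = (\<Sum>k. ennreal (poisson_mass (\<theta> / 2) k)
         * (\<integral>\<^sup>+x. emeasure (chi_square 1) {y. x + y \<in> A} \<partial>chi_square (2 * k + n)))"
    proof -
      let ?\<tau> = "density (count_space UNIV) (\<lambda>k. ennreal (poisson_mass (\<theta> / 2) k))"
      have nn: "(\<integral>\<^sup>+k. f k \<partial>?\<tau>) = (\<Sum>k. ennreal (poisson_mass (\<theta> / 2) k) * f k)" for f
        by (subst nn_integral_density) (auto simp: nn_integral_count_space_nat)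
      have "(\<integral>\<^sup>+x. f x \<partial>noncentral_chi_square n \<theta>)
          = (\<integral>\<^sup>+k. \<integral>\<^sup>+x. f x \<partial>chi_square (2 * k + n) \<partial>?\<tau>)" 
          if [measurable]: "f \<in> borel_measurable borel" for f
      proof (rule nn_integral_mixture[where S = borel])
        show "(\<lambda>k. chi_square (2 * k + n)) \<in> ?\<tau> \<rightarrow>\<^sub>M subprob_algebra borel"
          using \<open>n \<ge> 1\<close> by (auto simp: space_subprob_algebra prob_space_imp_subprob_space prob_space_chi_square)
        show "sets (noncentral_chi_square n \<theta>) = sets borel"
          by (simp add: noncentral_chi_square_def)
        show "emeasure (noncentral_chi_square n \<theta>) B = (\<integral>\<^sup>+k. emeasure (chi_square (2 * k + n)) B \<partial>?\<tau>)"
          if "B \<in> sets borel" for B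
          unfolding nn by (rule Suc.IH[OF that])
      qed simp_all
      thus ?thesis unfolding nn by (simp del: One_nat_def)
    qed
    also have "\<dots> = (\<Sum>k. ennreal (poisson_mass (\<theta> / 2) k) * emeasure (chi_square (2 * k + Suc n)) A)"
    proof (intro suminf_cong arg_cong2[where f = "(*)"] refl)
      fix k
      have fin: "finite_measure (chi_square (2 * k + n))" "finite_measure (chi_square 1)"
        using \<open>n \<ge> 1\<close> by (auto intro!: prob_space.finite_measure prob_space_chi_square)
      have "emeasure (chi_square (2 * k + Suc n)) A = emeasure (convolution (chi_square (2 * k + n)) (chi_square 1)) A"
        using \<open>n \<ge> 1\<close> by (subst chi_square_convolution) auto
      also have "\<dots> = (\<integral>\<^sup>+x. emeasure (chi_square 1) {y. x + y \<in> A} \<partial>chi_square (2 * k + n))"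
        using fin by (subst convolution_emeasure) (auto simp: add.commute)
      finally show "(\<integral>\<^sup>+x. emeasure (chi_square 1) {y. x + y \<in> A} \<partial>chi_square (2 * k + n))
          = emeasure (chi_square (2 * k + Suc n)) A" ..
    qed
    finally show ?case .
  qed
qed

lemma prob_space_noncentral_chi_square:
  "\<theta> \<ge> 0 \<Longrightarrow> prob_space (noncentral_chi_square n \<theta>)"
  "sets (noncentral_chi_square n \<theta>) = sets borel"
  using measurable_space[OF noncentral_chi_square_kernel, of \<theta> n]
  by (auto simp: space_prob_algebra noncentral_chi_square_def)

lemma noncentral_chi_square_poisson_rep:
  assumes "n \<ge> 1"
  shows "discrete_mixture_rep nonneg_borel borel (noncentral_chi_square n)
        (UNIV :: nat set) (\<lambda>\<theta> k. poisson_mass (\<theta> / 2) k) (\<lambda>k. chi_square (2 * k + n))"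
  using assms
  by (intro discrete_mixture_repI)
     (auto simp: prob_space_chi_square prob_space_noncentral_chi_square nn_integral_count_space_nat
        emeasure_noncentral_chi_square)

lemma noncentral_chi_square_0:
  assumes "n \<ge> 1" shows "noncentral_chi_square n 0 = chi_square n"
proof (rule measure_eqI)
  fix A assume "A \<in> sets (noncentral_chi_square n 0)"
  hence A: "A \<in> sets borel" by (simp add: prob_space_noncentral_chi_square)
  have "emeasure (noncentral_chi_square n 0) A
      = (\<Sum>k. ennreal (poisson_mass 0 k) * emeasure (chi_square (2 * k + n)) A)"
    using emeasure_noncentral_chi_square[OF assms order_refl A] by simp
  also have "\<dots> = (\<Sum>k\<in>{0}. ennreal (poisson_mass 0 k) * emeasure (chi_square (2 * k + n)) A)"
    by (rule suminf_finite) (auto simp: poisson_mass_def)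
  finally show "emeasure (noncentral_chi_square n 0) A = emeasure (chi_square n) A"
    by (simp add: poisson_mass_def)
qed (simp add: prob_space_noncentral_chi_square)

section \<open>Mixing over central distributions of all degrees of freedom\<close>

text \<open>
  The Poisson representation with the central distributions indexed by their degrees of freedom.
  Mixtures belonging to different \<open>n\<close> then live over one index set, so that a single uniqueness
  result compares them.
\<close>
lemma emeasure_noncentral_chi_square_weight:
  assumes "n \<ge> 1" "\<theta> \<ge> 0" "A \<in> sets borel"
  shows "emeasure (noncentral_chi_square n \<theta>) A
    = (\<integral>\<^sup>+j. ennreal (chi_square_weight (\<theta>, n) j) * emeasure (chi_square j) A \<partial>count_space {1..})"
proof -
  let ?g = "\<lambda>k. 2 * k + n"
  let ?f = "\<lambda>j. ennreal (chi_square_weight (\<theta>, n) j) * emeasure (chi_square j) A"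
  have "emeasure (noncentral_chi_square n \<theta>) A = (\<integral>\<^sup>+k. ?f (?g k) \<partial>count_space UNIV)"
    using assms by (simp add: emeasure_noncentral_chi_square nn_integral_count_space_nat chi_square_weight_def)
  also have "\<dots> = (\<integral>\<^sup>+j. ?f j \<partial>count_space (range ?g))"
    by (rule nn_integral_bij_count_space) (auto simp: inj_on_def bij_betw_def)
  also have "\<dots> = (\<integral>\<^sup>+j. ?f j \<partial>count_space {1..})"
  proof (rule nn_integral_count_space_eq)
    fix j assume j: "j \<in> {1..} - range ?g"
    have "\<not> (n \<le> j \<and> even (j - n))"
    proof
      assume "n \<le> j \<and> even (j - n)"
      hence "j = ?g ((j - n) div 2)" by auto
      thus False using j by blast
    qed
    hence "chi_square_weight (\<theta>, n) j = 0" by (simp only: chi_square_weight_def split_conv if_False)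
    thus "?f j = 0" by simp
  qed (use assms in auto)
  finally show ?thesis .
qed

lemma chi_square_weight_nonneg: "\<theta> \<ge> 0 \<Longrightarrow> 0 \<le> chi_square_weight (\<theta>, n) j"
  by (simp add: chi_square_weight_def)

lemma noncentral_chi_square_weight_rep:
  assumes "n \<ge> 1"
  shows "discrete_mixture_rep nonneg_borel borel (noncentral_chi_square n) {1..}
     (\<lambda>\<theta>. chi_square_weight (\<theta>, n)) chi_square"
  using assms
  by (intro discrete_mixture_repI)
     (auto simp: prob_space_chi_square prob_space_noncentral_chi_square
        emeasure_noncentral_chi_square_weight chi_square_weight_nonneg)

lemma noncentral_chi_square_pair_rep:
  "discrete_mixture_rep (nonneg_borel \<Otimes>\<^sub>M count_space {1..}) borel
        (\<lambda>(\<theta>, n). noncentral_chi_square n \<theta>) {1..} chi_square_weight chi_square"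
  by (intro discrete_mixture_repI)
     (auto simp: prob_space_chi_square prob_space_noncentral_chi_square space_pair_measure
        emeasure_noncentral_chi_square_weight chi_square_weight_nonneg)

lemma measurable_chi_square_weight:
  "(\<lambda>\<theta>. chi_square_weight (\<theta>, n) j) \<in> borel_measurable nonneg_borel"
  unfolding chi_square_weight_def poisson_mass_def split_conv
  by (intro measurable_restrict_space1) simp

lemma measurable_chi_square_weight_pair:
  "(\<lambda>p. chi_square_weight p j) \<in> borel_measurable (nonneg_borel \<Otimes>\<^sub>M count_space {1..})"
proof -
  have "(\<lambda>p. chi_square_weight (fst p, snd p) j) \<in> borel_measurable (nonneg_borel \<Otimes>\<^sub>M count_space {1..})"
    by (rule measurable_compose_countable'[where I = "{1..}" and g = snd])
       (auto intro: measurable_compose[OF measurable_fst measurable_chi_square_weight])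
  thus ?thesis by simp
qed

text \<open>
  Each central distribution is itself noncentral, with noncentrality parameter 0; so mixing
  measures are transported along \<open>k \<mapsto> (0, k)\<close>.
\<close>
lemma Mix_chi_square_subset_noncentral:
  "Mix (count_space {1..}) borel chi_square
     \<subseteq> Mix (nonneg_borel \<Otimes>\<^sub>M count_space {1..}) borel (\<lambda>(\<theta>, n). noncentral_chi_square n \<theta>)"
proof
  let ?T = "nonneg_borel \<Otimes>\<^sub>M count_space {1::nat..}"
  fix \<mu> assume "\<mu> \<in> Mix (count_space {1..}) borel chi_square"
  then obtain \<sigma> where \<mu>: "prob_space \<mu>" "sets \<mu> = sets borel"
    and \<sigma>: "prob_space \<sigma>" "sets \<sigma> = sets (count_space {1..})"
    and eq: "\<And>A. A \<in> sets borel \<Longrightarrow> emeasure \<mu> A = (\<integral>\<^sup>+k. emeasure (chi_square k) A \<partial>\<sigma>)"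
    unfolding Mix_def by blast
  have sp: "space \<sigma> = {1..}" using sets_eq_imp_space_eq[OF \<sigma>(2)] by simp
  have emb: "(\<lambda>k. (0, k)) \<in> \<sigma> \<rightarrow>\<^sub>M ?T"
    using \<sigma>(2) by (auto simp: measurable_cong_sets[OF \<sigma>(2) refl] space_pair_measure)
  have "(\<integral>\<^sup>+p. emeasure ((\<lambda>(\<theta>, n). noncentral_chi_square n \<theta>) p) A \<partial>distr \<sigma> ?T (\<lambda>k. (0, k)))
      = emeasure \<mu> A" if A: "A \<in> sets borel" for A
  proof -
    have "(\<lambda>p. emeasure ((\<lambda>(\<theta>, n). noncentral_chi_square n \<theta>) p) A) \<in> borel_measurable ?T"
      using measurable_prob_algebraD[OF noncentral_chi_square_pair_kernel] A
      by (rule measurable_emeasure_kernel)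
    hence "(\<integral>\<^sup>+p. emeasure ((\<lambda>(\<theta>, n). noncentral_chi_square n \<theta>) p) A \<partial>distr \<sigma> ?T (\<lambda>k. (0, k)))
       = (\<integral>\<^sup>+k. emeasure (noncentral_chi_square k 0) A \<partial>\<sigma>)"
      by (subst nn_integral_distr[OF emb]) auto
    also have "\<dots> = emeasure \<mu> A"
      unfolding eq[OF A] by (intro nn_integral_cong) (auto simp: sp noncentral_chi_square_0)
    finally show ?thesis .
  qed
  thus "\<mu> \<in> Mix ?T borel (\<lambda>(\<theta>, n). noncentral_chi_square n \<theta>)"
    using \<mu> prob_space.prob_space_distr[OF \<sigma>(1) emb] unfolding Mix_def
    by (intro CollectI conjI exI[of _ "distr \<sigma> ?T (\<lambda>k. (0, k))"])
       (simp_all del: One_nat_def)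
qed

lemma Mix_noncentral_chi_square_eq:
  "Mix (nonneg_borel \<Otimes>\<^sub>M count_space {1..}) borel (\<lambda>(\<theta>, n). noncentral_chi_square n \<theta>)
     = Mix (count_space {1..}) borel chi_square"
  using Mix_subset_of_discrete_mixture_rep[OF noncentral_chi_square_pair_rep measurable_chi_square_weight_pair]
    Mix_chi_square_subset_noncentral by blast

lemma Mix_noncentral_chi_square_mixing:
  assumes "n \<ge> 1" and "\<mu> \<in> Mix nonneg_borel borel (noncentral_chi_square n)"
  shows "\<exists>\<tau> \<sigma>. prob_space \<tau> \<and> sets \<tau> = sets nonneg_borel \<and> prob_space \<sigma> \<and> sets \<sigma> = Pow {1..} \<and>
    (\<forall>j\<ge>1. emeasure \<sigma> {j} = (\<integral>\<^sup>+\<theta>. ennreal (chi_square_weight (\<theta>, n) j) \<partial>\<tau>)) \<and>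
    (\<forall>A\<in>sets borel. emeasure \<mu> A = (\<integral>\<^sup>+j. emeasure (chi_square j) A \<partial>\<sigma>))"
proof -
  from assms(2) obtain \<tau> where \<tau>: "prob_space \<tau>" "sets \<tau> = sets nonneg_borel"
    and "\<And>A. A \<in> sets borel \<Longrightarrow> emeasure \<mu> A = (\<integral>\<^sup>+\<theta>. emeasure (noncentral_chi_square n \<theta>) A \<partial>\<tau>)"
    unfolding Mix_def by blast
  with discrete_mixture_rep_mixing[OF noncentral_chi_square_weight_rep[OF assms(1)]
      measurable_chi_square_weight \<tau>]
  show ?thesis by (auto intro!: exI[of _ \<tau>])
qed

section \<open>Strict inclusion for one degree of freedom and disjointness for different parities\<close>

lemma Mix_noncentral_chi_square_subset:
  assumes "n \<ge> 1"
  shows "Mix nonneg_borel borel (noncentral_chi_square n)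
    \<subseteq> Mix (count_space (UNIV :: nat set)) borel (\<lambda>k. chi_square (2 * k + n))"
  by (rule Mix_subset_of_discrete_mixture_rep[OF noncentral_chi_square_poisson_rep[OF assms]])
     (auto simp: poisson_mass_def intro!: measurable_restrict_space1)

text \<open>
  Every noncentral distribution charges the component \<open>chi_square 1\<close> with the positive weight
  \<open>exp (- \<theta> / 2)\<close>, and so does every mixture of them; by uniqueness of the mixing measure
  \<open>chi_square 3\<close> does not.
\<close>
lemma chi_square_3_notin_Mix:
  "chi_square 3 \<notin> Mix nonneg_borel borel (noncentral_chi_square 1)"
proof
  assume "chi_square 3 \<in> Mix nonneg_borel borel (noncentral_chi_square 1)"
  then obtain \<tau> \<sigma> where \<tau>: "prob_space \<tau>" "sets \<tau> = sets nonneg_borel"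
    and \<sigma>: "prob_space \<sigma>" "sets \<sigma> = Pow {1..}"
    and w: "emeasure \<sigma> {1} = (\<integral>\<^sup>+\<theta>. ennreal (chi_square_weight (\<theta>, 1) 1) \<partial>\<tau>)"
    and eq: "\<And>A. A \<in> sets borel \<Longrightarrow> emeasure (chi_square 3) A = (\<integral>\<^sup>+j. emeasure (chi_square j) A \<partial>\<sigma>)"
    using Mix_noncentral_chi_square_mixing[of 1] by (metis order_refl)
  interpret \<tau>: prob_space \<tau> by fact
  let ?\<delta> = "return (count_space {1..}) (3 :: nat)"
  have "\<sigma> = ?\<delta>"
  proof (rule chi_square_mixture_unique[OF \<sigma>])
    show "prob_space ?\<delta>" by (intro prob_space_return) simp
    show "(\<integral>\<^sup>+k. emeasure (chi_square k) A \<partial>\<sigma>) = (\<integral>\<^sup>+k. emeasure (chi_square k) A \<partial>?\<delta>)"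
      if "A \<in> sets borel" for A
      using eq[OF that] by (subst nn_integral_return) auto
  qed simp
  hence "(\<integral>\<^sup>+\<theta>. ennreal (exp (- (\<theta> / 2))) \<partial>\<tau>) = 0"
    using w by (simp add: chi_square_weight_def poisson_mass_def indicator_def)
  moreover have "(\<lambda>\<theta>. ennreal (exp (- (\<theta> / 2)))) \<in> borel_measurable \<tau>"
    unfolding measurable_cong_sets[OF \<tau>(2) refl] by (intro measurable_restrict_space1) simp
  ultimately have "AE \<theta> in \<tau>. False"
    by (subst (asm) nn_integral_0_iff_AE) auto
  thus False by simp
qed

lemma Mix_noncentral_chi_square_1_psubset:
  "Mix nonneg_borel borel (noncentral_chi_square 1)
     \<subset> Mix (count_space (UNIV :: nat set)) borel (\<lambda>k. chi_square (2 * k + 1))"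
proof -
  have "(\<lambda>k. chi_square (2 * k + 1)) \<in> count_space UNIV \<rightarrow>\<^sub>M prob_algebra borel"
    by (auto simp: space_prob_algebra prob_space_chi_square)
  from kernel_in_Mix[OF this, of 1]
  have "chi_square 3 \<in> Mix (count_space (UNIV :: nat set)) borel (\<lambda>k. chi_square (2 * k + 1))"
    by (simp add: numeral_3_eq_3)
  thus ?thesis
    using Mix_noncentral_chi_square_subset[of 1] chi_square_3_notin_Mix by auto
qed

text \<open>
  The mixing measures over the central distributions are carried by indices of opposite parity;
  uniqueness would make one such measure vanish at all points.
\<close>
lemma Mix_noncentral_chi_square_disjoint:
  assumes kl: "k \<ge> 1" "l \<ge> 1" and odd: "odd \<bar>int k - int l\<bar>"
  shows "Mix nonneg_borel borel (noncentral_chi_square k)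
          \<inter> Mix nonneg_borel borel (noncentral_chi_square l) = {}"
proof (rule ccontr)
  assume "\<not> ?thesis"
  then obtain \<mu> where \<mu>: "\<mu> \<in> Mix nonneg_borel borel (noncentral_chi_square k)"
      "\<mu> \<in> Mix nonneg_borel borel (noncentral_chi_square l)" by blast
  obtain \<tau> \<sigma> where \<sigma>: "prob_space \<sigma>" "sets \<sigma> = Pow {1..}"
    and w: "\<And>j. j \<ge> 1 \<Longrightarrow> emeasure \<sigma> {j} = (\<integral>\<^sup>+\<theta>. ennreal (chi_square_weight (\<theta>, k) j) \<partial>\<tau>)"
    and eq: "\<And>A. A \<in> sets borel \<Longrightarrow> emeasure \<mu> A = (\<integral>\<^sup>+j. emeasure (chi_square j) A \<partial>\<sigma>)"
    using Mix_noncentral_chi_square_mixing[OF kl(1) \<mu>(1)] by blast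
  obtain \<tau>' \<sigma>' where \<sigma>': "prob_space \<sigma>'" "sets \<sigma>' = Pow {1..}"
    and w': "\<And>j. j \<ge> 1 \<Longrightarrow> emeasure \<sigma>' {j} = (\<integral>\<^sup>+\<theta>. ennreal (chi_square_weight (\<theta>, l) j) \<partial>\<tau>')"
    and eq': "\<And>A. A \<in> sets borel \<Longrightarrow> emeasure \<mu> A = (\<integral>\<^sup>+j. emeasure (chi_square j) A \<partial>\<sigma>')"
    using Mix_noncentral_chi_square_mixing[OF kl(2) \<mu>(2)] by blast
  have "\<sigma> = \<sigma>'" using eq eq' by (intro chi_square_mixture_unique \<sigma> \<sigma>') metis
  have zero: "emeasure \<sigma> {j} = 0" if "j \<ge> 1" for j
  proof -
    from odd have "\<not> (k \<le> j \<and> even (j - k)) \<or> \<not> (l \<le> j \<and> even (j - l))"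
      by presburger
    hence "(\<forall>\<theta>. chi_square_weight (\<theta>, k) j = 0) \<or> (\<forall>\<theta>. chi_square_weight (\<theta>, l) j = 0)"
      unfolding chi_square_weight_def split_conv by presburger
    thus ?thesis
    proof
      assume "\<forall>\<theta>. chi_square_weight (\<theta>, k) j = 0"
      thus ?thesis using w[OF that] by simp
    next
      assume "\<forall>\<theta>. chi_square_weight (\<theta>, l) j = 0"
      thus ?thesis using w'[OF that] \<open>\<sigma> = \<sigma>'\<close> by simp
    qed
  qed
  thus False using prob_space_countable_atom[OF \<sigma>] by auto
qed

section \<open>Extremality and nonexistence of minimal representations\<close>

text \<open>
  Write \<open>t = \<theta> / 2\<close> and \<open>l = \<eta> / 2\<close>. Uniqueness of mixing measures says that the \<open>\<tau>\<close>-average of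
  each Poisson weight with rate \<open>t\<close> equals the Poisson weight with rate \<open>l\<close>. Three weights
  suffice: \<open>2 * p 2 - 2 * l * p 1 + l\<^sup>2 * p 0\<close> equals \<open>(t - l)\<^sup>2 * exp (- t)\<close> for the rate \<open>t\<close>,
  which is nonnegative, and it vanishes for the rate \<open>l\<close>. So its average is \<open>0\<close>, and \<open>t = l\<close>
  almost surely. This is a variance argument with a damping factor that avoids moments of \<open>\<tau>\<close>.
\<close>
lemma noncentral_chi_square_mixing_concentrated:
  assumes \<tau>: "prob_space \<tau>" "sets \<tau> = sets nonneg_borel" and \<eta>: "\<eta> \<ge> 0"
    and eq: "\<And>A. A \<in> sets borel \<Longrightarrow>
      emeasure (noncentral_chi_square 1 \<eta>) A = (\<integral>\<^sup>+\<theta>. emeasure (noncentral_chi_square 1 \<theta>) A \<partial>\<tau>)"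
  shows "AE \<theta> in \<tau>. \<theta> = \<eta>"
proof -
  let ?\<delta> = "return nonneg_borel \<eta>"
  have \<delta>: "prob_space ?\<delta>" "sets ?\<delta> = sets nonneg_borel"
    using \<eta> by (auto intro: prob_space_return)
  note rep = noncentral_chi_square_weight_rep[of 1, OF order_refl]
  obtain \<sigma> where \<sigma>: "prob_space \<sigma>" "sets \<sigma> = Pow {1..}"
    and w: "\<And>j. j \<ge> 1 \<Longrightarrow> emeasure \<sigma> {j} = (\<integral>\<^sup>+\<theta>. ennreal (chi_square_weight (\<theta>, 1) j) \<partial>\<tau>)"
    and mix: "\<And>A. A \<in> sets borel \<Longrightarrow>
      (\<integral>\<^sup>+\<theta>. emeasure (noncentral_chi_square 1 \<theta>) A \<partial>\<tau>) = (\<integral>\<^sup>+j. emeasure (chi_square j) A \<partial>\<sigma>)"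
    using discrete_mixture_rep_mixing[OF rep measurable_chi_square_weight \<tau>] by auto
  obtain \<sigma>' where \<sigma>': "prob_space \<sigma>'" "sets \<sigma>' = Pow {1..}"
    and w': "\<And>j. j \<ge> 1 \<Longrightarrow> emeasure \<sigma>' {j} = (\<integral>\<^sup>+\<theta>. ennreal (chi_square_weight (\<theta>, 1) j) \<partial>?\<delta>)"
    and mix': "\<And>A. A \<in> sets borel \<Longrightarrow>
      (\<integral>\<^sup>+\<theta>. emeasure (noncentral_chi_square 1 \<theta>) A \<partial>?\<delta>) = (\<integral>\<^sup>+j. emeasure (chi_square j) A \<partial>\<sigma>')"
    using discrete_mixture_rep_mixing[OF rep measurable_chi_square_weight \<delta>] by auto
  have \<eta>_sp: "\<eta> \<in> space nonneg_borel" using \<eta> by simp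
  have kern: "(\<lambda>\<theta>. emeasure (noncentral_chi_square 1 \<theta>) A) \<in> borel_measurable nonneg_borel"
    if "A \<in> sets borel" for A
    using measurable_prob_algebraD[OF noncentral_chi_square_kernel] that
    by (rule measurable_emeasure_kernel)
  have "\<sigma> = \<sigma>'"
  proof (rule chi_square_mixture_unique[OF \<sigma> \<sigma>'])
    fix A :: "real set" assume A: "A \<in> sets borel"
    show "(\<integral>\<^sup>+k. emeasure (chi_square k) A \<partial>\<sigma>) = (\<integral>\<^sup>+k. emeasure (chi_square k) A \<partial>\<sigma>')"
      using mix[OF A] mix'[OF A] eq[OF A] nn_integral_return[OF \<eta>_sp kern[OF A]] by simp
  qed
  have meas: "f \<in> borel_measurable \<tau>" if "f \<in> borel_measurable borel" for f :: "real \<Rightarrow> real"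
    unfolding measurable_cong_sets[OF \<tau>(2) refl] using that by (rule measurable_restrict_space1)
  have weight: "(\<integral>\<^sup>+\<theta>. ennreal (poisson_mass (\<theta> / 2) k) \<partial>\<tau>) = ennreal (poisson_mass (\<eta> / 2) k)" for k
  proof -
    have "(\<integral>\<^sup>+\<theta>. ennreal (poisson_mass (\<theta> / 2) k) \<partial>\<tau>) = emeasure \<sigma>' {2 * k + 1}"
      using w[of "2 * k + 1"] \<open>\<sigma> = \<sigma>'\<close> by (simp add: chi_square_weight_def)
    also have "\<dots> = (\<integral>\<^sup>+\<theta>. ennreal (chi_square_weight (\<theta>, 1) (2 * k + 1)) \<partial>?\<delta>)"
      by (rule w') simp
    also have "\<dots> = ennreal (chi_square_weight (\<eta>, 1) (2 * k + 1))"
      by (intro nn_integral_return[OF \<eta>_sp] measurable_compose[OF measurable_chi_square_weight measurable_ennreal])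
    finally show ?thesis by (simp add: chi_square_weight_def)
  qed
  define l where "l = \<eta> / 2"
  have l: "l \<ge> 0" using \<eta> by (simp add: l_def)
  \<comment> \<open>The combination of Poisson weights at 0, 1, 2; the equation below is stated without
    subtraction since it lives in \<open>ennreal\<close>.\<close>
  define V where "V = (\<lambda>\<theta>. (\<theta> / 2 - l)\<^sup>2 * exp (- (\<theta> / 2)))"
  have V_meas: "V \<in> borel_measurable \<tau>" by (rule meas) (simp add: V_def)
  have P_meas: "(\<lambda>\<theta>. poisson_mass (\<theta> / 2) k) \<in> borel_measurable \<tau>" for k
    by (rule meas) (simp add: poisson_mass_def)
  have sp: "space \<tau> = {0..}" using sets_eq_imp_space_eq[OF \<tau>(2)] by simp
  have V_nonneg: "0 \<le> V \<theta>" for \<theta> by (simp add: V_def)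
  note [measurable] = V_meas P_meas
  have "(\<integral>\<^sup>+\<theta>. ennreal (V \<theta>) \<partial>\<tau>) + ennreal (2 * l) * (\<integral>\<^sup>+\<theta>. ennreal (poisson_mass (\<theta> / 2) 1) \<partial>\<tau>)
      = (\<integral>\<^sup>+\<theta>. ennreal (V \<theta>) + ennreal (2 * l) * ennreal (poisson_mass (\<theta> / 2) 1) \<partial>\<tau>)"
    by (simp add: nn_integral_add nn_integral_cmult)
  also have "\<dots> = (\<integral>\<^sup>+\<theta>. ennreal (V \<theta> + 2 * l * poisson_mass (\<theta> / 2) 1) \<partial>\<tau>)"
    using l V_nonneg by (intro nn_integral_cong) (simp add: sp ennreal_mult)
  also have "\<dots> = (\<integral>\<^sup>+\<theta>. ennreal (2 * poisson_mass (\<theta> / 2) 2 + l\<^sup>2 * poisson_mass (\<theta> / 2) 0) \<partial>\<tau>)"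
    by (intro nn_integral_cong arg_cong[where f = ennreal])
       (simp add: V_def poisson_mass_def power2_eq_square algebra_simps)
  also have "\<dots> = (\<integral>\<^sup>+\<theta>. ennreal 2 * ennreal (poisson_mass (\<theta> / 2) 2)
      + ennreal (l\<^sup>2) * ennreal (poisson_mass (\<theta> / 2) 0) \<partial>\<tau>)"
    by (intro nn_integral_cong) (simp add: sp ennreal_mult del: ennreal_numeral)
  also have "\<dots> = ennreal 2 * (\<integral>\<^sup>+\<theta>. ennreal (poisson_mass (\<theta> / 2) 2) \<partial>\<tau>)
      + ennreal (l\<^sup>2) * (\<integral>\<^sup>+\<theta>. ennreal (poisson_mass (\<theta> / 2) 0) \<partial>\<tau>)"
    by (simp add: nn_integral_add nn_integral_cmult del: ennreal_numeral)
  also have "\<dots> = ennreal (2 * poisson_mass l 2 + l\<^sup>2 * poisson_mass l 0)"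
    using l unfolding weight l_def[symmetric] by (simp add: ennreal_mult del: ennreal_numeral)
  also have "2 * poisson_mass l 2 + l\<^sup>2 * poisson_mass l 0 = 2 * l * poisson_mass l 1"
    by (simp add: poisson_mass_def power2_eq_square algebra_simps)
  also have "ennreal \<dots> = ennreal (2 * l) * (\<integral>\<^sup>+\<theta>. ennreal (poisson_mass (\<theta> / 2) 1) \<partial>\<tau>)"
    using l unfolding weight l_def[symmetric] by (simp add: ennreal_mult)
  finally have "(\<integral>\<^sup>+\<theta>. ennreal (V \<theta>) \<partial>\<tau>) = 0"
    unfolding weight by (simp add: ennreal_add_eq_top ennreal_mult_eq_top_iff)
  hence "AE \<theta> in \<tau>. V \<theta> = 0"
    using V_meas by (subst (asm) nn_integral_0_iff_AE) (auto simp: V_def)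
  thus ?thesis by (rule AE_mp) (auto simp: V_def l_def)
qed

lemma noncentral_chi_square_inj: "inj_on (noncentral_chi_square 1) {0..}"
proof (rule inj_onI)
  fix \<eta> \<eta>' :: real assume nn: "\<eta> \<in> {0..}" "\<eta>' \<in> {0..}"
    and eq: "noncentral_chi_square 1 \<eta> = noncentral_chi_square 1 \<eta>'"
  let ?\<delta> = "return nonneg_borel \<eta>'"
  have "AE \<theta> in ?\<delta>. \<theta> = \<eta>"
  proof (rule noncentral_chi_square_mixing_concentrated)
    fix A :: "real set" assume A: "A \<in> sets borel"
    show "emeasure (noncentral_chi_square 1 \<eta>) A = (\<integral>\<^sup>+\<theta>. emeasure (noncentral_chi_square 1 \<theta>) A \<partial>?\<delta>)"
      using nn A unfolding eq
      by (subst nn_integral_return)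
         (auto intro: measurable_emeasure_kernel measurable_prob_algebraD[OF noncentral_chi_square_kernel])
  qed (use nn in \<open>auto intro: prob_space_return\<close>)
  moreover have "Measurable.pred nonneg_borel (\<lambda>\<theta>. \<theta> = \<eta>)"
    by (intro measurable_restrict_space1) simp
  ultimately show "\<eta> = \<eta>'" using nn by (subst (asm) AE_return) auto
qed

text \<open>
  A convex combination of two mixtures is again a mixture, by first choosing one of the two
  mixing measures with a Bernoulli variable. The combined mixing measure must be concentrated at
  \<open>\<eta>\<close>, hence so must both of the given ones.
\<close>
lemma noncentral_chi_square_extremal:
  assumes \<eta>: "\<eta> \<ge> 0"
  shows "extremal_in borel (Mix nonneg_borel borel (noncentral_chi_square 1)) (noncentral_chi_square 1 \<eta>)"
  unfolding extremal_in_def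
proof (intro conjI ballI allI impI)
  let ?\<chi> = "noncentral_chi_square 1" and ?M = "Mix nonneg_borel borel (noncentral_chi_square 1)"
  show "?\<chi> \<eta> \<in> ?M" using \<eta> by (intro kernel_in_Mix noncentral_chi_square_kernel) simp
  fix \<mu>1 \<mu>2 :: "real measure" and \<alpha> :: real
  assume \<mu>12: "\<mu>1 \<in> ?M" "\<mu>2 \<in> ?M"
    and asm: "0 < \<alpha> \<and> \<alpha> < 1 \<and>
      (\<forall>A\<in>sets borel. measure (?\<chi> \<eta>) A = \<alpha> * measure \<mu>1 A + (1 - \<alpha>) * measure \<mu>2 A)"
  interpret \<mu>1: prob_space \<mu>1 using \<mu>12 by (simp add: Mix_def)
  interpret \<mu>2: prob_space \<mu>2 using \<mu>12 by (simp add: Mix_def)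
  interpret \<chi>: prob_space "?\<chi> \<eta>" using \<eta> by (rule prob_space_noncentral_chi_square)
  obtain \<tau>1 where \<tau>1: "prob_space \<tau>1" "sets \<tau>1 = sets nonneg_borel"
    and eq1: "\<And>A. A \<in> sets borel \<Longrightarrow> emeasure \<mu>1 A = (\<integral>\<^sup>+\<theta>. emeasure (?\<chi> \<theta>) A \<partial>\<tau>1)"
    using \<mu>12(1) unfolding Mix_def by blast
  obtain \<tau>2 where \<tau>2: "prob_space \<tau>2" "sets \<tau>2 = sets nonneg_borel"
    and eq2: "\<And>A. A \<in> sets borel \<Longrightarrow> emeasure \<mu>2 A = (\<integral>\<^sup>+\<theta>. emeasure (?\<chi> \<theta>) A \<partial>\<tau>2)"
    using \<mu>12(2) unfolding Mix_def by blast
  \<comment> \<open>The mixture \<open>\<alpha> * \<tau>1 + (1 - \<alpha>) * \<tau>2\<close> of the two mixing measures.\<close>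
  let ?B = "measure_pmf (bernoulli_pmf \<alpha>)" and ?K = "\<lambda>b. if b then \<tau>1 else \<tau>2"
  define \<tau> where "\<tau> = ?B \<bind> ?K"
  have B: "?B \<in> space (prob_algebra (count_space UNIV))"
    by (simp add: space_prob_algebra prob_space_measure_pmf)
  have K: "?K \<in> count_space UNIV \<rightarrow>\<^sub>M prob_algebra nonneg_borel"
    using \<tau>1 \<tau>2 by (auto simp: space_prob_algebra)
  have K': "?K \<in> ?B \<rightarrow>\<^sub>M subprob_algebra nonneg_borel"
    using measurable_prob_algebraD[OF K] by (simp cong: measurable_cong_sets)
  have "AE \<theta> in \<tau>. \<theta> = \<eta>"
  proof (rule noncentral_chi_square_mixing_concentrated[OF _ _ \<eta>])
    show "prob_space \<tau>" unfolding \<tau>_def by (rule prob_space_bind'[OF B K])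
    show "sets \<tau> = sets nonneg_borel" unfolding \<tau>_def by (rule sets_bind'[OF B K])
    fix A :: "real set" assume A: "A \<in> sets borel"
    have "(\<integral>\<^sup>+\<theta>. emeasure (?\<chi> \<theta>) A \<partial>\<tau>) = (\<integral>\<^sup>+b. (\<integral>\<^sup>+\<theta>. emeasure (?\<chi> \<theta>) A \<partial>?K b) \<partial>?B)"
      unfolding \<tau>_def
      by (intro nn_integral_bind[OF _ K'] measurable_emeasure_kernel[OF _ A]
          measurable_prob_algebraD[OF noncentral_chi_square_kernel])
    also have "\<dots> = ennreal \<alpha> * emeasure \<mu>1 A + ennreal (1 - \<alpha>) * emeasure \<mu>2 A"
      using asm by (simp add: eq1[OF A] eq2[OF A] mult.commute)
    also have "\<dots> = emeasure (?\<chi> \<eta>) A"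
      using asm A by (simp add: \<mu>1.emeasure_eq_measure \<mu>2.emeasure_eq_measure
          \<chi>.emeasure_eq_measure ennreal_mult del: One_nat_def)
    finally show "emeasure (?\<chi> \<eta>) A = (\<integral>\<^sup>+\<theta>. emeasure (?\<chi> \<theta>) A \<partial>\<tau>)" ..
  qed
  moreover have "Measurable.pred nonneg_borel (\<lambda>\<theta>. \<theta> = \<eta>)"
    by (intro measurable_restrict_space1) simp
  ultimately have "AE b in ?B. AE \<theta> in ?K b. \<theta> = \<eta>"
    unfolding \<tau>_def by (subst (asm) AE_bind[OF K']) auto
  hence "\<forall>b. AE \<theta> in ?K b. \<theta> = \<eta>"
    using asm by (simp add: AE_measure_pmf_iff set_pmf_bernoulli)
  from spec[OF this, of True] spec[OF this, of False]
  have AE: "AE \<theta> in \<tau>1. \<theta> = \<eta>" "AE \<theta> in \<tau>2. \<theta> = \<eta>"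
    by (simp_all only: if_True if_False)
  have Dirac: "\<mu> = ?\<chi> \<eta>"
    if "prob_space \<tau>'" "AE \<theta> in \<tau>'. \<theta> = \<eta>" "\<mu> \<in> ?M"
      "\<And>A. A \<in> sets borel \<Longrightarrow> emeasure \<mu> A = (\<integral>\<^sup>+\<theta>. emeasure (?\<chi> \<theta>) A \<partial>\<tau>')" for \<mu> \<tau>'
  proof (rule measure_eqI)
    show "sets \<mu> = sets (?\<chi> \<eta>)" using that(3) by (simp add: Mix_def prob_space_noncentral_chi_square)
    fix A assume "A \<in> sets \<mu>"
    hence A: "A \<in> sets borel" using that(3) by (simp add: Mix_def)
    have "emeasure \<mu> A = (\<integral>\<^sup>+\<theta>. emeasure (?\<chi> \<eta>) A \<partial>\<tau>')"
      unfolding that(4)[OF A] using that(2) by (intro nn_integral_cong_AE) (auto elim!: eventually_mono)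
    thus "emeasure \<mu> A = emeasure (?\<chi> \<eta>) A"
      using prob_space.emeasure_space_1[OF that(1)] by simp
  qed
  show "\<mu>1 = ?\<chi> \<eta>" by (rule Dirac[OF \<tau>1(1) AE(1) \<mu>12(1) eq1])
  show "\<mu>2 = ?\<chi> \<eta>" by (rule Dirac[OF \<tau>2(1) AE(2) \<mu>12(2) eq2])
qed

text \<open>
  A minimal representation would generate the uncountably many extremal points
  \<open>noncentral_chi_square 1 \<eta>\<close> from countably many distributions.
\<close>
lemma no_minimal_discrete_mixture_rep_noncentral:
  "\<not> minimal_discrete_mixture_rep nonneg_borel borel (noncentral_chi_square 1) I w Q"
proof
  assume "minimal_discrete_mixture_rep nonneg_borel borel (noncentral_chi_square 1) I w Q"
  hence I: "countable I" and Q: "\<And>i. i \<in> I \<Longrightarrow> prob_space (Q i) \<and> sets (Q i) = sets borel"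
    and eq: "Mix nonneg_borel borel (noncentral_chi_square 1) = Mix (count_space I) borel Q"
    unfolding minimal_discrete_mixture_rep_def discrete_mixture_rep_def by auto
  have "noncentral_chi_square 1 ` {0..} \<subseteq> Q ` I"
  proof (rule image_subsetI)
    fix \<eta> :: real assume "\<eta> \<in> {0..}"
    hence "extremal_in borel (Mix (count_space I) borel Q) (noncentral_chi_square 1 \<eta>)"
      using noncentral_chi_square_extremal[of \<eta>] unfolding eq by simp
    from extremal_in_countable_Mix[OF I Q this] obtain i
      where "i \<in> I" "Q i = noncentral_chi_square 1 \<eta>" by blast
    thus "noncentral_chi_square 1 \<eta> \<in> Q ` I" by (intro image_eqI[of _ _ i]) simp_all
  qed
  hence "countable (noncentral_chi_square 1 ` {0..})"
    using I by (meson countable_image countable_subset)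
  hence "countable {0::real..}" by (rule countable_image_inj_on[OF _ noncentral_chi_square_inj])
  hence "countable {0..1::real}" by (rule countable_subset[rotated]) auto
  thus False using uncountable_closed_interval[of 0 "1::real"] by simp
qed

theorem theorem10:
  shows
    "(discrete_mixture_rep nonneg_borel borel (noncentral_chi_square 1)
        (UNIV :: nat set) (\<lambda>\<theta> k. poisson_mass (\<theta> / 2) k) (\<lambda>k. chi_square (2 * k + 1)) \<and>
      \<not> minimal_discrete_mixture_rep nonneg_borel borel (noncentral_chi_square 1)
        (UNIV :: nat set) (\<lambda>\<theta> k. poisson_mass (\<theta> / 2) k) (\<lambda>k. chi_square (2 * k + 1)) \<and>
      Mix nonneg_borel borel (noncentral_chi_square 1)
        \<subset> Mix (count_space (UNIV :: nat set)) borel (\<lambda>k. chi_square (1 + 2 * k)) \<and>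
      (\<forall>\<eta>\<ge>0. extremal_in borel (Mix nonneg_borel borel (noncentral_chi_square 1))
                (noncentral_chi_square 1 \<eta>)) \<and>
      \<not> (\<exists>(I :: 'i set) w Q.
            minimal_discrete_mixture_rep nonneg_borel borel (noncentral_chi_square 1) I w Q))
     \<and>
     ((\<forall>n\<ge>1. discrete_mixture_rep nonneg_borel borel (noncentral_chi_square n)
        (UNIV :: nat set) (\<lambda>\<theta> k. poisson_mass (\<theta> / 2) k) (\<lambda>k. chi_square (2 * k + n))) \<and>
      minimal_discrete_mixture_rep (nonneg_borel \<Otimes>\<^sub>M count_space {1..}) borel
        (\<lambda>(\<theta>, n). noncentral_chi_square n \<theta>) {1..} chi_square_weight chi_square \<and>
      Mix (nonneg_borel \<Otimes>\<^sub>M count_space {1..}) borel (\<lambda>(\<theta>, k). noncentral_chi_square k \<theta>)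
        = Mix (count_space {1..}) borel chi_square)
     \<and>
     (\<forall>k\<ge>1. \<forall>l\<ge>1. odd \<bar>int k - int l\<bar> \<longrightarrow>
        Mix nonneg_borel borel (noncentral_chi_square k)
          \<inter> Mix nonneg_borel borel (noncentral_chi_square l) = {})"
proof (intro conjI allI impI)
  show "minimal_discrete_mixture_rep (nonneg_borel \<Otimes>\<^sub>M count_space {1..}) borel
      (\<lambda>(\<theta>, n). noncentral_chi_square n \<theta>) {1..} chi_square_weight chi_square"
    unfolding minimal_discrete_mixture_rep_def
    by (intro conjI noncentral_chi_square_pair_rep Mix_noncentral_chi_square_eq)
  have "(\<lambda>k. chi_square (1 + 2 * k)) = (\<lambda>k. chi_square (2 * k + 1))"
    by (simp only: add.commute)
  thus "Mix nonneg_borel borel (noncentral_chi_square 1)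
      \<subset> Mix (count_space (UNIV :: nat set)) borel (\<lambda>k. chi_square (1 + 2 * k))"
    using Mix_noncentral_chi_square_1_psubset by (simp only:)
qed (use noncentral_chi_square_poisson_rep noncentral_chi_square_extremal no_minimal_discrete_mixture_rep_noncentral
    Mix_noncentral_chi_square_eq Mix_noncentral_chi_square_disjoint in \<open>blast+\<close>)

end
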